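(* As formal power series, $A_{\{1,2,3\}}(x,y)$ is equal to \[ \frac{1-x-x^2y-x^3y}{(1-x-x^2y-x^3y)(1-xy - x^2y^2 - x^3y^3) - (2x^2y + 4x^3y + 2x^3y^2 + 2x^4y^2 + 2x^5y)}, \] and for any integer $c \geq 1$, $A_{\{c,2c,3c\}}(x,y) = A_{\{1,2,3\}}(x^c,y^c)$.
   Context: A composition of $n$ is an ordered list of positive integers (parts) with sum $n$; the empty list is the unique composition of $0$. A meander on $n$ nodes is a pair $\frac{\lambda}{\mu}$ of compositions of $n$, viewed as a planar (multi)graph on vertices $1,\dots,n$: for each part $a$ of $\lambda$, occupying the consecutive vertices $p+1,\dots,p+a$ (where $p$ is the sum of the preceding parts), there is an upper edge joining $p+i$ and $p+a+1-i$ for each $1\le i\le \lfloor a/2\rfloor$; lower edges are defined in the same way from $\mu$. If the same two vertices are joined by both an upper and a lower edge, both edges are kept and form a cycle. Every connected component is a cycle or a path (an isolated vertex counts as a path). The index is $\operatorname{ind}(\frac{\lambda}{\mu}) = 2c+p$, where here $c$ is the number of cycles and $p$ is the number of paths (this equals the index of the associated seaweed subalgebra of $\mathfrak{gl}_n$). For a set $J$ of positive integers, $a^J_{n,k}$ is the number of meanders $\frac{\lambda}{\mu}$ on $n$ nodes of index $k$ such that all parts of $\lambda$ and $\mu$ lie in $J$, and $A_J(x,y)=\sum_{n,k\ge 0} a^J_{n,k}x^ny^k$ (the empty meander gives $a^J_{0,0}=1$). *)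

theory Defs
  imports "HOL-Computational_Algebra.Computational_Algebra"
begin

section \<open>Finite multigraphs\<close>

text \<open>A multigraph has a vertex set \<open>V\<close>, a set \<open>E\<close> of edge names (so that parallel edges
  are possible) and a map \<open>ends\<close> sending an edge to its set of endpoints.\<close>

definition connected_components :: "'v set \<Rightarrow> 'e set \<Rightarrow> ('e \<Rightarrow> 'v set) \<Rightarrow> 'v set set" where
  "connected_components V E ends =
     V // {(u, v). u \<in> V \<and> v \<in> V \<and> (u, v) \<in> {(u, v). \<exists>e\<in>E. ends e = {u, v}}\<^sup>*}"

definition induced_edges :: "'e set \<Rightarrow> ('e \<Rightarrow> 'v set) \<Rightarrow> 'v set \<Rightarrow> 'e set" where
  "induced_edges E ends C = {e \<in> E. ends e \<subseteq> C}"

text \<open>The sub-multigraph induced on \<open>C\<close> is a path: its vertices and edges are listed without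
  repetition as \<open>v\<^sub>0 e\<^sub>0 v\<^sub>1 e\<^sub>1 \<dots> v\<^sub>m\<close>.  The case \<open>m = 0\<close> is an isolated vertex.\<close>

definition is_path :: "'e set \<Rightarrow> ('e \<Rightarrow> 'v set) \<Rightarrow> 'v set \<Rightarrow> bool" where
  "is_path E ends C \<longleftrightarrow>
     (\<exists>vs es. distinct vs \<and> set vs = C \<and>
              distinct es \<and> set es = induced_edges E ends C \<and>
              length vs = length es + 1 \<and>
              (\<forall>i<length es. ends (es ! i) = {vs ! i, vs ! (i + 1)}))"

text \<open>Likewise a cycle \<open>v\<^sub>0 e\<^sub>0 v\<^sub>1 \<dots> v\<^sub>m e\<^sub>m v\<^sub>0\<close>; two parallel edges form a cycle of
  length 2.\<close>

definition is_cycle :: "'e set \<Rightarrow> ('e \<Rightarrow> 'v set) \<Rightarrow> 'v set \<Rightarrow> bool" where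
  "is_cycle E ends C \<longleftrightarrow>
     (\<exists>vs es. distinct vs \<and> set vs = C \<and>
              distinct es \<and> set es = induced_edges E ends C \<and>
              length vs = length es \<and> length es \<ge> 2 \<and>
              (\<forall>i<length es. ends (es ! i) = {vs ! i, vs ! ((i + 1) mod length es)}))"


section \<open>Meanders\<close>

definition composition :: "nat \<Rightarrow> nat list \<Rightarrow> bool" where
  "composition n l \<longleftrightarrow> (\<forall>a\<in>set l. a > 0) \<and> sum_list l = n"

definition meander :: "nat \<Rightarrow> nat list \<times> nat list \<Rightarrow> bool" where
  "meander n M \<longleftrightarrow> composition n (fst M) \<and> composition n (snd M)"

definition arcs_of :: "nat list \<Rightarrow> nat set set" where
  "arcs_of l = {{p + i, p + a + 1 - i} | j p a i.
     j < length l \<and> p = sum_list (take j l) \<and> a = l ! j \<and> 1 \<le> i \<and> i \<le> a div 2}"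

text \<open>Upper and lower edges are kept apart by taking the disjoint sum: \<open>Inl\<close> marks an upper,
  \<open>Inr\<close> a lower edge.\<close>

definition meander_edges :: "nat list \<times> nat list \<Rightarrow> (nat set + nat set) set" where
  "meander_edges M = arcs_of (fst M) <+> arcs_of (snd M)"

definition meander_ends :: "nat set + nat set \<Rightarrow> nat set" where
  "meander_ends = case_sum id id"

definition meander_components :: "nat list \<times> nat list \<Rightarrow> nat set set" where
  "meander_components M =
     connected_components {1..sum_list (fst M)} (meander_edges M) meander_ends"

definition meander_index :: "nat list \<times> nat list \<Rightarrow> nat" where
  "meander_index M =
     2 * card {C \<in> meander_components M. is_cycle (meander_edges M) meander_ends C} +
     card {C \<in> meander_components M. is_path (meander_edges M) meander_ends C}"


section \<open>Generating functions\<close>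

definition meander_count :: "nat set \<Rightarrow> nat \<Rightarrow> nat \<Rightarrow> nat" where
  "meander_count J n k =
     card {M. meander n M \<and> set (fst M) \<subseteq> J \<and> set (snd M) \<subseteq> J \<and> meander_index M = k}"

text \<open>Bivariate series are series in \<open>x\<close> whose coefficients are series in \<open>y\<close>: the coefficient
  of \<open>x\<^sup>n y\<^sup>k\<close> in \<open>F\<close> is \<open>fps_nth (fps_nth F n) k\<close>.  Although \<open>rat fps\<close> is not a field, \<open>/\<close>
  on \<open>rat fps fps\<close> is the true quotient whenever the denominator is 1 at \<open>x = 0\<close>.\<close>

definition meander_gf :: "nat set \<Rightarrow> rat fps fps" where
  "meander_gf J = Abs_fps (\<lambda>n. Abs_fps (\<lambda>k. of_nat (meander_count J n k)))"

abbreviation var_x :: "rat fps fps" where "var_x \<equiv> fps_X"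

abbreviation var_y :: "rat fps fps" where "var_y \<equiv> fps_const fps_X"

text \<open>The substitution \<open>F(x\<^sup>c, y\<^sup>c)\<close>, meaningful for \<open>c \<ge> 1\<close>: replace \<open>y\<close> in each coefficient,
  then replace \<open>x\<close>.\<close>

definition subst_powers :: "nat \<Rightarrow> rat fps fps \<Rightarrow> rat fps fps" where
  "subst_powers c F = fps_compose (Abs_fps (\<lambda>n. fps_compose (fps_nth F n) (fps_X ^ c))) (fps_X ^ c)"

end

theory Submission
  imports Defs
begin

text \<open>A composition acts on the vertices as the involution reversing each of its parts. If \<open>u\<close> and \<open>l\<close>
  are the involutions of the two compositions, a path of the meander is a single orbit of
  \<open>u \<circ> l\<close> and a cycle splits into two, so the index is the number of orbits of \<open>u \<circ> l\<close>.

  Scaling all parts by \<open>c\<close> turns \<open>u \<circ> l\<close> into \<open>c\<close> disjoint copies of itself, which gives the second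
  claim. For the first, deleting a vertex reduces a meander with first parts \<open>1/2\<close>, \<open>1/3\<close> or \<open>2/3\<close>
  to a smaller one without changing the index. Writing \<open>S(p/q)\<close> for the series of the meanders
  whose two compositions start with \<open>p\<close> and \<open>q\<close>, these reductions close up into a linear
  system for \<open>A = S(/)\<close>, \<open>T = S(/1)\<close> and \<open>U = S(/1,1)\<close>.\<close>

section \<open>Orbits of a self-map\<close>

text \<open>The generating relation is symmetric and confined to \<open>V\<close>, so its closure is
  an equivalence relation even if \<open>p\<close> is not injective or leaves \<open>V\<close>. A
  point outside \<open>V\<close> is related only to itself.\<close>

definition orbit_rel :: "'a set \<Rightarrow> ('a \<Rightarrow> 'a) \<Rightarrow> ('a \<times> 'a) set" where
  "orbit_rel V p = {(x, y). x \<in> V \<and> y \<in> V \<and> (y = p x \<or> x = p y)}\<^sup>*"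

definition num_orbits :: "'a set \<Rightarrow> ('a \<Rightarrow> 'a) \<Rightarrow> nat" where
  "num_orbits V p = card ((\<lambda>x. orbit_rel V p `` {x}) ` V)"

lemma orbit_rel_refl [simp]: "(x, x) \<in> orbit_rel V p"
  by (simp add: orbit_rel_def)

lemma orbit_rel_trans: "(x, y) \<in> orbit_rel V p \<Longrightarrow> (y, z) \<in> orbit_rel V p \<Longrightarrow> (x, z) \<in> orbit_rel V p"
  unfolding orbit_rel_def by (rule rtrancl_trans)

lemma orbit_rel_sym: "(x, y) \<in> orbit_rel V p \<Longrightarrow> (y, x) \<in> orbit_rel V p"
  unfolding orbit_rel_def by (rule symD[OF sym_rtrancl]) (auto simp: sym_def)

lemma orbit_rel_step: "x \<in> V \<Longrightarrow> p x \<in> V \<Longrightarrow> (x, p x) \<in> orbit_rel V p"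
  unfolding orbit_rel_def by (rule r_into_rtrancl) auto

lemma orbit_rel_class_eq:
  "orbit_rel V p `` {x} = orbit_rel V p `` {y} \<longleftrightarrow> (x, y) \<in> orbit_rel V p"
proof
  assume "orbit_rel V p `` {x} = orbit_rel V p `` {y}"
  moreover have "y \<in> orbit_rel V p `` {y}" by simp
  ultimately have "y \<in> orbit_rel V p `` {x}" by blast
  then show "(x, y) \<in> orbit_rel V p" by simp
next
  assume "(x, y) \<in> orbit_rel V p"
  then show "orbit_rel V p `` {x} = orbit_rel V p `` {y}"
    using orbit_rel_trans orbit_rel_sym by fast
qed

text \<open>A chain may run \<open>p\<close> forwards or backwards, hence the equivalence in the
  hypothesis. This is the tool for showing that two points lie in different orbits.\<close>

lemma orbit_rel_invariant:
  assumes "(x, y) \<in> orbit_rel V p" "x \<in> S"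
    and "\<And>x. x \<in> V \<Longrightarrow> p x \<in> V \<Longrightarrow> x \<in> S \<longleftrightarrow> p x \<in> S"
  shows "y \<in> S"
  using assms(1,2) unfolding orbit_rel_def
  by (induction rule: rtrancl_induct) (use assms(3) in auto)

text \<open>One step of \<open>p\<close> may be sent to a whole chain of \<open>p'\<close>, so
  \<open>f\<close> need not commute with the two maps.\<close>

lemma orbit_rel_map:
  assumes "(x, y) \<in> orbit_rel V p"
    and "\<And>x. x \<in> V \<Longrightarrow> p x \<in> V \<Longrightarrow> (f x, f (p x)) \<in> orbit_rel V' p'"
  shows "(f x, f y) \<in> orbit_rel V' p'"
  using assms(1) unfolding orbit_rel_def[of V]
proof (induction rule: rtrancl_induct)
  case (step y z)
  then have "(f y, f z) \<in> orbit_rel V' p'"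
    using assms(2) orbit_rel_sym by fastforce
  with step.IH show ?case by (rule orbit_rel_trans)
qed simp

section \<open>Comparing the orbit numbers of two maps\<close>

text \<open>No bijection is needed: maps in both directions that are mutually inverse up to orbits
  suffice, so that the lemma also covers the deletion of a point from its orbit.\<close>

lemma num_orbits_eq:
  assumes f: "\<And>x. x \<in> V \<Longrightarrow> f x \<in> V'" and g: "\<And>z. z \<in> V' \<Longrightarrow> g z \<in> V"
    and fp: "\<And>x. x \<in> V \<Longrightarrow> p x \<in> V \<Longrightarrow> (f x, f (p x)) \<in> orbit_rel V' p'"
    and gp: "\<And>z. z \<in> V' \<Longrightarrow> p' z \<in> V' \<Longrightarrow> (g z, g (p' z)) \<in> orbit_rel V p"
    and fg: "\<And>z. z \<in> V' \<Longrightarrow> (f (g z), z) \<in> orbit_rel V' p'"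
    and gf: "\<And>x. x \<in> V \<Longrightarrow> (g (f x), x) \<in> orbit_rel V p"
  shows "num_orbits V p = num_orbits V' p'"
proof -
  have iff: "(x, y) \<in> orbit_rel V p \<longleftrightarrow> (f x, f y) \<in> orbit_rel V' p'" if "x \<in> V" "y \<in> V" for x y
  proof
    assume "(x, y) \<in> orbit_rel V p"
    then show "(f x, f y) \<in> orbit_rel V' p'"
      by (rule orbit_rel_map) (rule fp)
  next
    assume "(f x, f y) \<in> orbit_rel V' p'"
    then have "(g (f x), g (f y)) \<in> orbit_rel V p"
      by (rule orbit_rel_map) (rule gp)
    with gf[OF that(1)] gf[OF that(2)] show "(x, y) \<in> orbit_rel V p"
      by (blast intro: orbit_rel_sym orbit_rel_trans)
  qed
  let ?c = "\<lambda>x. orbit_rel V p `` {x}" and ?c' = "\<lambda>x. orbit_rel V' p' `` {x}"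
  \<comment> \<open>A class is sent to the class of the image of a chosen representative; by
    \<open>iff\<close> the choice does not matter.\<close>
  define h where "h X = ?c' (f (SOME x. x \<in> V \<and> ?c x = X))" for X
  have h: "h (?c x) = ?c' (f x)" if "x \<in> V" for x
  proof -
    have "(SOME y. y \<in> V \<and> ?c y = ?c x) \<in> V \<and> ?c (SOME y. y \<in> V \<and> ?c y = ?c x) = ?c x"
      by (rule someI[of _ x]) (use that in auto)
    then show ?thesis
      unfolding h_def orbit_rel_class_eq using iff that by blast
  qed
  have "bij_betw h (?c ` V) (?c' ` V')"
    unfolding bij_betw_def
  proof
    show "inj_on h (?c ` V)"
    proof (rule inj_onI)
      fix X Y assume "X \<in> ?c ` V" "Y \<in> ?c ` V" "h X = h Y"
      then obtain x y where "x \<in> V" "y \<in> V" "X = ?c x" "Y = ?c y" by blast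
      with \<open>h X = h Y\<close> show "X = Y"
        by (simp add: h orbit_rel_class_eq iff)
    qed
    have "?c' z \<in> h ` ?c ` V" if "z \<in> V'" for z
    proof -
      have "?c' z = h (?c (g z))"
        using that fg[OF that] by (simp add: h g orbit_rel_class_eq orbit_rel_sym)
      then show ?thesis using g that by blast
    qed
    then show "h ` ?c ` V = ?c' ` V'"
      using f by (auto simp: h)
  qed
  then show ?thesis
    unfolding num_orbits_def by (rule bij_betw_same_card)
qed

lemma num_orbits_bij:
  assumes "\<And>x. x \<in> V \<Longrightarrow> f x \<in> V'" "\<And>z. z \<in> V' \<Longrightarrow> g z \<in> V"
    and "\<And>x. x \<in> V \<Longrightarrow> g (f x) = x" "\<And>z. z \<in> V' \<Longrightarrow> f (g z) = z"
    and "\<And>x. x \<in> V \<Longrightarrow> f (p x) = p' (f x)"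
    and "\<And>x. x \<in> V \<Longrightarrow> p x \<in> V"
  shows "num_orbits V p = num_orbits V' p'"
proof (rule num_orbits_eq[where f = f and g = g])
  show "(g z, g (p' z)) \<in> orbit_rel V p" if "z \<in> V'" "p' z \<in> V'" for z
  proof -
    have "g (p' z) = p (g z)" using assms that by metis
    then show ?thesis using assms that by (simp add: orbit_rel_step)
  qed
  show "(f x, f (p x)) \<in> orbit_rel V' p'" if "x \<in> V" for x
    using assms(1)[OF that] assms(1)[OF assms(6)[OF that]]
    by (simp add: assms(5) that orbit_rel_step)
qed (simp_all add: assms)

lemma num_orbits_inverse:
  assumes "\<And>x. x \<in> V \<Longrightarrow> p x \<in> V" "\<And>x. x \<in> V \<Longrightarrow> p' x \<in> V"
    and "\<And>x. x \<in> V \<Longrightarrow> p (p' x) = x" "\<And>x. x \<in> V \<Longrightarrow> p' (p x) = x"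
  shows "num_orbits V p = num_orbits V p'"
proof (rule num_orbits_eq[where f = id and g = id])
  show "(id x, id (p x)) \<in> orbit_rel V p'" if "x \<in> V" for x
    using orbit_rel_sym[OF orbit_rel_step[of "p x" V p']] assms that by simp
  show "(id x, id (p' x)) \<in> orbit_rel V p" if "x \<in> V" for x
    using orbit_rel_sym[OF orbit_rel_step[of "p' x" V p]] assms that by simp
qed auto

text \<open>No chain crosses between the two invariant disjoint parts in either direction, so each
  class of the union is a class of one part.\<close>

lemma num_orbits_Un:
  assumes "finite A" "finite B" "A \<inter> B = {}"
    and A: "\<And>x. x \<in> A \<Longrightarrow> p x \<in> A" and B: "\<And>x. x \<in> B \<Longrightarrow> p x \<in> B"
  shows "num_orbits (A \<union> B) p = num_orbits A p + num_orbits B p"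
proof -
  let ?c = "\<lambda>V x. orbit_rel V p `` {x}"
  have "?c (A \<union> B) x = ?c X x \<and> ?c X x \<subseteq> X"
    if X: "x \<in> X" "(X = A \<or> X = B)" for x X
  proof -
    have sub: "y \<in> X" if "(x, y) \<in> orbit_rel (A \<union> B) p" for y
      using orbit_rel_invariant[OF that X(1)] X A B assms(3) by blast
    have "(x, y) \<in> orbit_rel X p \<and> y \<in> X" if "(x, y) \<in> orbit_rel (A \<union> B) p" for y
      using that unfolding orbit_rel_def[of "A \<union> B"]
    proof (induction rule: rtrancl_induct)
      case (step y z)
      then have "z \<in> X" using X A B assms(3) by blast
      then have "(y, z) \<in> orbit_rel X p"
        using step unfolding orbit_rel_def by (intro r_into_rtrancl) auto
      with step \<open>z \<in> X\<close> show ?case by (auto intro: orbit_rel_trans)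
    qed (use X in simp)
    moreover have "orbit_rel X p \<subseteq> orbit_rel (A \<union> B) p"
      unfolding orbit_rel_def by (rule rtrancl_mono) (use X in auto)
    ultimately show ?thesis by blast
  qed
  then have *: "\<And>x. x \<in> A \<Longrightarrow> ?c (A \<union> B) x = ?c A x" "\<And>x. x \<in> A \<Longrightarrow> ?c A x \<subseteq> A"
    "\<And>x. x \<in> B \<Longrightarrow> ?c (A \<union> B) x = ?c B x" "\<And>x. x \<in> B \<Longrightarrow> ?c B x \<subseteq> B"
    by simp_all
  have "?c (A \<union> B) ` (A \<union> B) = ?c A ` A \<union> ?c B ` B"
    unfolding image_Un by (intro arg_cong2[where f = "(\<union>)"] image_cong refl *)
  moreover have "?c A a \<noteq> ?c B b" if "a \<in> A" "b \<in> B" for a b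
  proof -
    have "a \<in> ?c A a" by simp
    moreover have "a \<notin> ?c B b" using *(4)[OF that(2)] that(1) assms(3) by blast
    ultimately show ?thesis by blast
  qed
  then have "?c A ` A \<inter> ?c B ` B = {}" by blast
  ultimately show ?thesis
    unfolding num_orbits_def using assms by (simp add: card_Un_disjoint)
qed

lemma num_orbits_identity:
  assumes "\<And>x. x \<in> V \<Longrightarrow> p x = x"
  shows "num_orbits V p = card V"
proof -
  have "y = x" if "(x, y) \<in> orbit_rel V p" for x y
    using orbit_rel_invariant[OF that, of "{x}"] assms by auto
  then have "orbit_rel V p `` {x} = {x}" for x
    by auto
  then show ?thesis by (simp add: num_orbits_def card_image)
qed

text \<open>Points sent to \<open>z\<close> are redirected to \<open>p z\<close>. The orbit of
  \<open>z\<close> survives because it still contains \<open>p z\<close>, which differs from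
  \<open>z\<close>.\<close>

lemma num_orbits_remove_point:
  assumes "z \<in> V" "p z \<noteq> z" "\<And>x. x \<in> V \<Longrightarrow> p x \<in> V"
  shows "num_orbits V p = num_orbits (V - {z}) (\<lambda>x. if p x = z then p z else p x)"
    (is "_ = num_orbits ?V ?p")
proof (rule num_orbits_eq[where f = "\<lambda>x. if x = z then p z else x" and g = id])
  show "((if x = z then p z else x), (if p x = z then p z else p x)) \<in> orbit_rel ?V ?p"
    if "x \<in> V" for x
  proof (cases "x = z")
    case False
    then have "x \<in> ?V" "?p x \<in> ?V" using assms that by auto
    from orbit_rel_step[of x ?V ?p, OF this] False show ?thesis by simp
  qed (use assms in simp)
  have z: "(z, p z) \<in> orbit_rel V p"
    by (rule orbit_rel_step) (simp_all add: assms)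
  show "(id x, id (?p x)) \<in> orbit_rel V p" if "x \<in> ?V" for x
  proof -
    have "(x, p x) \<in> orbit_rel V p"
      by (rule orbit_rel_step) (use that assms in auto)
    with z show ?thesis by (auto intro: orbit_rel_trans)
  qed
  show "(id (if x = z then p z else x), x) \<in> orbit_rel V p" for x
    using orbit_rel_sym[OF z] by simp
  show "(if id x = z then p z else id x, x) \<in> orbit_rel ?V ?p" if "x \<in> ?V" for x
    using that by simp
qed (use assms in auto)


section \<open>Paths and cycles of two involutions\<close>

definition involution_edges :: "'a set \<Rightarrow> ('a \<Rightarrow> 'a) \<Rightarrow> 'a set set" where
  "involution_edges V f = {{v, f v} | v. v \<in> V \<and> f v \<noteq> v}"

lemma finite_range_collision:
  fixes f :: "nat \<Rightarrow> 'a"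
  assumes "finite C" "\<And>i. f i \<in> C"
  shows "\<exists>i j. f i = f j \<and> i < j"
proof (rule ccontr)
  assume "\<nexists>i j. f i = f j \<and> i < j"
  then have "inj f" by (intro linorder_injI) blast
  moreover have "finite (range f)" by (rule finite_subset[OF _ assms(1)]) (use assms(2) in auto)
  ultimately have "finite (UNIV :: nat set)" by (rule finite_imageD[rotated])
  then show False by simp
qed

text \<open>Abstract form of a meander: upper edges join \<open>v\<close> with \<open>u v\<close>,
  lower edges join \<open>v\<close> with \<open>l v\<close>, and a fixed point of \<open>u\<close>
  or \<open>l\<close> is a vertex without an edge on that side.\<close>

locale two_involutions =
  fixes V :: "nat set" and u l :: "nat \<Rightarrow> nat"
  assumes fin: "finite V"
    and u_in: "v \<in> V \<Longrightarrow> u v \<in> V" and l_in: "v \<in> V \<Longrightarrow> l v \<in> V"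
    and u_u: "v \<in> V \<Longrightarrow> u (u v) = v" and l_l: "v \<in> V \<Longrightarrow> l (l v) = v"
begin

definition E :: "(nat set + nat set) set" where
  "E = involution_edges V u <+> involution_edges V l"

abbreviation comps :: "nat set set" where
  "comps \<equiv> connected_components V E meander_ends"

abbreviation q :: "nat \<Rightarrow> nat" where "q v \<equiv> u (l v)"

text \<open>Even indices stand for the lower side and odd ones for the upper side, so a single
  counter drives an alternating walk and only its parity matters.\<close>

definition step :: "nat \<Rightarrow> nat \<Rightarrow> nat" where
  "step i = (if even i then l else u)"

definition edge :: "nat \<Rightarrow> nat \<Rightarrow> nat set + nat set" where
  "edge i v = (if even i then Inr {v, l v} else Inl {v, u v})"

text \<open>The parity of \<open>s\<close> chooses the side of the first step. At a vertex without
  an edge on the current side the walk stalls for one step and then retraces its way.\<close>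

fun walk :: "nat \<Rightarrow> nat \<Rightarrow> nat \<Rightarrow> nat" where
  "walk s v 0 = v"
| "walk s v (Suc i) = step (s + i) (walk s v i)"

declare walk.simps(2) [simp del]

lemma step_in: "v \<in> V \<Longrightarrow> step i v \<in> V"
  by (simp add: step_def u_in l_in)

lemma step_step: "v \<in> V \<Longrightarrow> even (i + j) \<Longrightarrow> step i (step j v) = v"
  by (auto simp: step_def u_u l_l)

lemma step_cong: "even (i + j) \<Longrightarrow> step i = step j"
  by (auto simp: step_def)

lemma ends_edge [simp]: "meander_ends (edge i v) = {v, step i v}"
  by (simp add: edge_def step_def meander_ends_def)

lemma mem_E_iff: "e \<in> E \<longleftrightarrow> (\<exists>v i. v \<in> V \<and> step i v \<noteq> v \<and> e = edge i v)"
proof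
  assume "e \<in> E"
  then consider v where "e = Inl {v, u v}" "v \<in> V" "u v \<noteq> v"
    | v where "e = Inr {v, l v}" "v \<in> V" "l v \<noteq> v"
    by (auto simp: E_def involution_edges_def)
  then show "\<exists>v i. v \<in> V \<and> step i v \<noteq> v \<and> e = edge i v"
  proof cases
    case 1 then show ?thesis by (intro exI[of _ v] exI[of _ 1]) (simp add: step_def edge_def)
  next
    case 2 then show ?thesis by (intro exI[of _ v] exI[of _ 0]) (simp add: step_def edge_def)
  qed
next
  assume "\<exists>v i. v \<in> V \<and> step i v \<noteq> v \<and> e = edge i v"
  then show "e \<in> E"
    by (auto simp: E_def involution_edges_def step_def edge_def split: if_splits)
qed

lemma edge_cong: "even (i + j) \<Longrightarrow> edge i v = edge j v"
  by (auto simp: edge_def)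

lemma edge_step: "v \<in> V \<Longrightarrow> edge i (step i v) = edge i v"
  by (auto simp: edge_def step_def u_u l_l)

lemma edge_eqD: "edge i v = edge j w \<Longrightarrow> even (i + j) \<and> (v = w \<or> v = step j w)"
  by (auto simp: edge_def step_def doubleton_eq_iff split: if_splits)

section \<open>Components of the multigraph\<close>

definition adj :: "(nat \<times> nat) set" where
  "adj = {(v, w). \<exists>e\<in>E. meander_ends e = {v, w}}"

lemma sym_adj: "sym adj"
  by (auto simp: adj_def sym_def insert_commute)

lemma adj_step: "v \<in> V \<Longrightarrow> (v, step i v) \<in> adj\<^sup>*"
proof (cases "step i v = v")
  case False
  assume "v \<in> V"
  with False have "edge i v \<in> E" by (auto simp: mem_E_iff)
  then show ?thesis by (intro r_into_rtrancl) (auto simp: adj_def intro!: bexI[of _ "edge i v"])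
qed simp

lemma adjD: "(v, w) \<in> adj \<Longrightarrow> \<exists>i. w = step i v"
proof -
  assume "(v, w) \<in> adj"
  then obtain a i where "a \<in> V" "{a, step i a} = {v, w}"
    by (auto simp: adj_def mem_E_iff)
  then have "w = step i v" by (auto simp: doubleton_eq_iff step_step)
  then show ?thesis ..
qed

lemma comps_eq: "comps = (\<lambda>x. {y \<in> V. (x, y) \<in> adj\<^sup>*}) ` V"
  by (auto simp: connected_components_def quotient_def adj_def)

lemma comps_class:
  assumes "C \<in> comps" "v \<in> C"
  shows "C = {y \<in> V. (v, y) \<in> adj\<^sup>*}"
proof -
  have "sym (adj\<^sup>*)" by (rule sym_rtrancl[OF sym_adj])
  with assms show ?thesis
    unfolding comps_eq sym_def by (auto intro: rtrancl_trans)
qed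

lemma comps_sub: "C \<in> comps \<Longrightarrow> C \<subseteq> V"
  by (auto simp: comps_eq)

lemma comps_step: "C \<in> comps \<Longrightarrow> v \<in> C \<Longrightarrow> step i v \<in> C"
  using comps_class[of C v] adj_step[of v i] step_in by auto

text \<open>Adjacent vertices differ by one step, so a component is generated by steps from any of
  its vertices. A list of vertices closed under steps is thus seen to exhaust its component.\<close>

lemma comps_least:
  assumes "C \<in> comps" "v \<in> C" "v \<in> S" and S: "\<And>x i. x \<in> S \<Longrightarrow> step i x \<in> S"
  shows "C \<subseteq> S"
proof
  fix y assume "y \<in> C"
  with comps_class[OF assms(1,2)] have "(v, y) \<in> adj\<^sup>*" by blast
  then show "y \<in> S"
    by (induction rule: rtrancl_induct) (use assms(3) in \<open>auto dest: adjD intro: S\<close>)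
qed

section \<open>Alternating walks and their coincidences\<close>

lemma walk_in: "C \<in> comps \<Longrightarrow> v \<in> C \<Longrightarrow> walk s v i \<in> C"
  by (induction i) (auto simp: walk.simps(2) intro: comps_step)

lemma walk_back:
  assumes "walk s v i \<in> V"
  shows "step (s + i) (walk s v (Suc i)) = walk s v i"
  using assms by (simp add: walk.simps(2) step_step)

text \<open>Two consecutive steps apply \<open>q\<close> or its inverse, according to the parity of
  \<open>s + i\<close>.\<close>

lemma walk_orbit_rel:
  assumes "\<And>i. walk s v i \<in> V"
  shows "(walk s v i, walk s v (Suc (Suc i))) \<in> orbit_rel V q"
proof (cases "even (s + i)")
  case True
  then have "walk s v (Suc (Suc i)) = q (walk s v i)" by (simp add: walk.simps(2) step_def)
  then show ?thesis using orbit_rel_step[of "walk s v i" V q] assms[of i] assms[of "Suc (Suc i)"]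
    by simp
next
  case False
  then have eq: "walk s v (Suc (Suc i)) = l (u (walk s v i))" by (simp add: walk.simps(2) step_def)
  have w: "walk s v i \<in> V" by (rule assms)
  have "q (walk s v (Suc (Suc i))) = walk s v i"
    unfolding eq using w by (simp add: u_u l_l u_in)
  then show ?thesis
    using orbit_rel_sym[OF orbit_rel_step[of "walk s v (Suc (Suc i))" V q]]
      assms[of i] assms[of "Suc (Suc i)"] by simp
qed

lemma walk_orbit_rel_even:
  assumes "\<And>i. walk s v i \<in> V"
  shows "(walk s v i, walk s v (i + 2 * j)) \<in> orbit_rel V q"
proof (induction j)
  case (Suc j)
  have "(walk s v (i + 2 * j), walk s v (i + 2 * Suc j)) \<in> orbit_rel V q"
    using walk_orbit_rel[OF assms, of "i + 2 * j"] by simp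
  with Suc show ?case by (rule orbit_rel_trans)
qed simp

text \<open>A coincidence of the walk at two times of different parity propagates inwards until two
  consecutive vertices agree; one at times of equal parity propagates back to the start.\<close>

lemma walk_odd_collision:
  assumes "\<And>i. walk s v i \<in> V" "walk s v i = walk s v (i + 2 * d + 1)"
  shows "\<exists>k\<le>i + d. walk s v k = walk s v (Suc k)"
  using assms(2)
proof (induction d arbitrary: i)
  case 0
  then show ?case by auto
next
  case (Suc d)
  have "walk s v (Suc i) = step (s + i) (walk s v (i + 2 * Suc d + 1))"
    using Suc.prems by (simp add: walk.simps(2))
  also have "\<dots> = step (s + (Suc i + 2 * d + 1)) (walk s v (Suc (Suc i + 2 * d + 1)))"
    by (subst step_cong[of "s + i" "s + (Suc i + 2 * d + 1)"]) simp_all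
  also have "\<dots> = walk s v (Suc i + 2 * d + 1)"
    by (rule walk_back) (rule assms)
  finally obtain k where "k \<le> Suc i + d" "walk s v k = walk s v (Suc k)"
    using Suc.IH by blast
  then show ?case by (intro exI[of _ k]) simp
qed

lemma walk_even_collision:
  assumes "\<And>i. walk s v i \<in> V" "walk s v i = walk s v (i + 2 * d)"
  shows "walk s v (2 * d) = v"
  using assms(2)
proof (induction i)
  case (Suc i)
  have "walk s v i = step (s + i) (walk s v (Suc i))"
    by (rule walk_back[symmetric]) (rule assms)
  also have "\<dots> = step (s + (i + 2 * d)) (walk s v (Suc (i + 2 * d)))"
    using Suc.prems by (subst step_cong[of "s + i" "s + (i + 2 * d)"]) simp_all
  also have "\<dots> = walk s v (i + 2 * d)"
    by (rule walk_back) (rule assms)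
  finally show ?case by (rule Suc.IH)
qed simp

section \<open>Components with a vertex of degree at most one\<close>

text \<open>The vertex \<open>v\<close> is an end of the path: it has no edge on the side that the
  first step does not use. The walk from \<open>v\<close> up to its first stall lists the component
  without repetition.\<close>

lemma fixed_point_path:
  assumes C: "C \<in> comps" "v \<in> C" and fixed: "step (Suc s) v = v"
  shows "is_path E meander_ends C" "\<And>a b. a \<in> C \<Longrightarrow> b \<in> C \<Longrightarrow> (a, b) \<in> orbit_rel V q"
proof -
  let ?w = "walk s v"
  have wC: "?w i \<in> C" for i using C by (rule walk_in)
  have wV: "?w i \<in> V" for i using wC comps_sub[OF C(1)] by blast
  have finC: "finite C" using comps_sub[OF C(1)] fin by (rule finite_subset)
  \<comment> \<open>If the walk never stalled, a repetition at odd distance would contradict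
    \<open>walk_odd_collision\<close>. One at even distance would bring the walk back to
    \<open>v\<close>, and the last step, on the side fixing \<open>v\<close>, would be a
    stall.\<close>
  have ex: "\<exists>k. ?w k = ?w (Suc k)"
  proof (rule ccontr)
    assume no: "\<nexists>k. ?w k = ?w (Suc k)"
    obtain i j where ij: "?w i = ?w j" "i < j"
      using finite_range_collision[OF finC wC] by blast
    show False
    proof (cases "even (j - i)")
      case True
      then obtain d where "j - i = 2 * d" by (elim evenE)
      with ij have d: "j = i + 2 * d" "d > 0" by auto
      with ij walk_even_collision[OF wV, of i d] have "?w (2 * d) = v" by simp
      moreover obtain d' where "d = Suc d'" using d by (cases d) auto
      ultimately have *: "?w (Suc (Suc (2 * d'))) = v" by simp
      have "?w (Suc (2 * d')) = step (s + Suc (2 * d')) v"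
        using walk_back[of s v "Suc (2 * d')", OF wV] unfolding * by simp
      also have "\<dots> = v" using fixed step_cong[of "s + Suc (2 * d')" "Suc s"] by simp
      finally show False using no * by metis
    next
      case False
      then obtain d where "j - i = 2 * d + 1" by (elim oddE)
      with ij have "j = i + 2 * d + 1" by auto
      with ij walk_odd_collision[OF wV, of i d] no show False by auto
    qed
  qed
  \<comment> \<open>The first stall marks the other end of the path; \<open>m = 0\<close> if
    \<open>v\<close> is isolated.\<close>
  define m where "m = (LEAST k. ?w k = ?w (Suc k))"
  have m: "?w m = ?w (Suc m)" unfolding m_def using ex by (rule LeastI_ex)
  have least: "?w k \<noteq> ?w (Suc k)" if "k < m" for k
    using not_less_Least that unfolding m_def by blast
  have neq: "?w i \<noteq> ?w j" if "i < j" "j \<le> m" for i j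
  proof
    assume eq: "?w i = ?w j"
    show False
    proof (cases "even (j - i)")
      case True
      then obtain d where "j - i = 2 * d" by (elim evenE)
      with that have d: "j = i + 2 * d" "d > 0" by auto
      with eq walk_even_collision[OF wV, of i d] have "?w (2 * d) = v" by simp
      moreover obtain d' where d': "d = Suc d'" using d by (cases d) auto
      ultimately have *: "?w (Suc (Suc (2 * d'))) = v" by simp
      have "?w (Suc (2 * d')) = step (s + Suc (2 * d')) v"
        using walk_back[of s v "Suc (2 * d')", OF wV] unfolding * by simp
      also have "\<dots> = v" using fixed step_cong[of "s + Suc (2 * d')" "Suc s"] by simp
      finally show False using least[of "Suc (2 * d')"] * d d' that by simp
    next
      case False
      then obtain d where "j - i = 2 * d + 1" by (elim oddE)
      with that have d: "j = i + 2 * d + 1" by auto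
      with eq walk_odd_collision[OF wV, of i d] obtain k where "k \<le> i + d" "?w k = ?w (Suc k)"
        by blast
      with least[of k] d that show False by simp
    qed
  qed
  have inj: "i = j" if "?w i = ?w j" "i \<le> m" "j \<le> m" for i j
    using neq[of i j] neq[of j i] that by (cases i j rule: linorder_cases) auto
  \<comment> \<open>A step from a listed vertex moves forwards, moves back, or is blocked at one of
    the two ends; any edge it uses is among the first \<open>m\<close> edges of the walk.\<close>
  have pre: "\<exists>k\<le>m. step i (?w j) = ?w k \<and>
      (step i (?w j) \<noteq> ?w j \<longrightarrow> (\<exists>k<m. edge i (?w j) = edge (s + k) (?w k)))" if "j \<le> m" for i j
  proof (cases "even (i + (s + j))")
    case True
    then have st: "step i (?w j) = ?w (Suc j)" using step_cong[of i "s + j"] by (simp add: walk.simps(2))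
    show ?thesis
    proof (cases "j = m")
      case True
      with st m show ?thesis by auto
    next
      case False
      with that st show ?thesis using edge_cong[OF \<open>even (i + (s + j))\<close>]
        by (intro exI[of _ "Suc j"] conjI impI exI[of _ j]) auto
    qed
  next
    case False
    show ?thesis
    proof (cases j)
      case 0
      with False have "step i v = v" using step_cong[of i "Suc s"] fixed by simp
      with 0 show ?thesis by auto
    next
      case (Suc j')
      with False have ev: "even (i + (s + j'))" by simp
      then have "step i (?w j) = ?w j'"
        using step_cong[OF ev] walk_back[OF wV, of j'] Suc by simp
      moreover have "edge i (?w j) = edge (s + j') (?w j')"
        using edge_cong[OF ev] edge_step[OF wV[of j'], of "s + j'"] Suc by (simp add: walk.simps(2))
      ultimately show ?thesis using Suc that
        by (intro exI[of _ j'] conjI impI) auto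
    qed
  qed
  have Cw: "C = ?w ` {..m}"
  proof
    show "C \<subseteq> ?w ` {..m}"
    proof (rule comps_least[OF C])
      show "v \<in> ?w ` {..m}" by (rule image_eqI[of _ _ 0]) auto
      show "step i x \<in> ?w ` {..m}" if "x \<in> ?w ` {..m}" for x i
        using that pre by blast
    qed
  qed (use wC in auto)
  define vs where "vs = map ?w [0..<Suc m]"
  define es where "es = map (\<lambda>i. edge (s + i) (?w i)) [0..<m]"
  show "is_path E meander_ends C"
    unfolding is_path_def
  proof (intro exI[of _ vs] exI[of _ es] conjI)
    show "distinct vs"
      unfolding vs_def distinct_map by (auto simp: inj_on_def less_Suc_eq_le intro: inj simp del: upt_Suc)
    show "set vs = C" unfolding vs_def Cw by (auto simp: less_Suc_eq_le simp del: upt_Suc)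
    show "distinct es"
      unfolding es_def distinct_map
    proof (intro conjI inj_onI)
      fix i j assume ij: "i \<in> set [0..<m]" "j \<in> set [0..<m]"
        "edge (s + i) (?w i) = edge (s + j) (?w j)"
      with edge_eqD[OF ij(3)] have "even (i + j)" "?w i = ?w j \<or> ?w i = ?w (Suc j)"
        by (auto simp: walk.simps(2))
      with ij inj[of i j] inj[of i "Suc j"] show "i = j" by auto
    qed simp
    show "set es = induced_edges E meander_ends C"
    proof
      show "set es \<subseteq> induced_edges E meander_ends C"
      proof
        fix e assume "e \<in> set es"
        then obtain i where i: "i < m" "e = edge (s + i) (?w i)" by (auto simp: es_def)
        with least[OF i(1)] wV[of i] have "e \<in> E"
          unfolding mem_E_iff by (intro exI[of _ "?w i"] exI[of _ "s + i"]) (simp add: walk.simps(2))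
        then show "e \<in> induced_edges E meander_ends C"
          unfolding induced_edges_def using i wC[of i] wC[of "Suc i"] by (auto simp: walk.simps(2))
      qed
      show "induced_edges E meander_ends C \<subseteq> set es"
      proof
        fix e assume "e \<in> induced_edges E meander_ends C"
        then obtain a i where a: "step i a \<noteq> a" "e = edge i a" "a \<in> C"
          unfolding induced_edges_def mem_E_iff by auto
        then obtain j where "j \<le> m" "a = ?w j" unfolding Cw by auto
        with pre[of j i] a show "e \<in> set es" unfolding es_def by auto
      qed
    qed
    show "length vs = length es + 1" by (simp add: vs_def es_def)
    show "\<forall>i<length es. meander_ends (es ! i) = {vs ! i, vs ! (i + 1)}"
      by (auto simp: vs_def es_def walk.simps(2) simp del: upt_Suc)
  qed
  have "(v, ?w 1) \<in> orbit_rel V q"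
  proof (cases "even s")
    case True
    then have "?w 1 = l v" "u v = v" using fixed by (auto simp: walk.simps(2) step_def)
    then have "q (?w 1) = v" using wV[of 0] by (simp add: l_l)
    then show ?thesis using orbit_rel_sym[OF orbit_rel_step[of "?w 1" V q]] wV[of 1] wV[of 0] by simp
  next
    case False
    then have "?w 1 = q v" using fixed by (auto simp: walk.simps(2) step_def)
    then show ?thesis using orbit_rel_step[of v V q] wV[of 1] wV[of 0] by simp
  qed
  then have "(v, ?w i) \<in> orbit_rel V q" for i
    using walk_orbit_rel_even[OF wV, of 0 "i div 2"] walk_orbit_rel_even[OF wV, of 1 "i div 2"]
      orbit_rel_trans[of v "?w 1" V q "?w i"]
    by (cases "even i") (auto elim!: evenE oddE)
  then show "(a, b) \<in> orbit_rel V q" if "a \<in> C" "b \<in> C" for a b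
    using that unfolding Cw by (blast intro: orbit_rel_trans orbit_rel_sym)
qed

section \<open>Components in which every vertex has degree two\<close>

text \<open>A walk that never stalls repeats only at even distances, so it first closes up at its
  start after an even number \<open>m\<close> of steps. The even and the odd positions then form the
  two orbits of \<open>q\<close>.\<close>

lemma no_fixed_point_cycle:
  assumes C: "C \<in> comps" and no: "\<And>v i. v \<in> C \<Longrightarrow> step i v \<noteq> v"
  shows "is_cycle E meander_ends C" "card ((\<lambda>x. orbit_rel V q `` {x}) ` C) = 2"
proof -
  obtain v where v: "v \<in> C" using C by (auto simp: comps_eq)
  let ?w = "walk 0 v"
  have wC: "?w i \<in> C" for i using C v by (rule walk_in)
  have wV: "?w i \<in> V" for i using wC comps_sub[OF C(1)] by blast
  have finC: "finite C" using comps_sub[OF C(1)] fin by (rule finite_subset)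
  have no': "?w k \<noteq> ?w (Suc k)" for k using no[OF wC[of k], of k] by (simp add: walk.simps(2))
  have same_parity: "even i = even j" if "?w i = ?w j" for i j
  proof -
    have "False" if "?w i = ?w j" "i < j" and odd: "odd (j - i)" for i j
    proof -
      obtain d where "j - i = 2 * d + 1" using odd by (elim oddE)
      with that have "j = i + 2 * d + 1" by auto
      with that walk_odd_collision[OF wV, of i d] no' show False by auto
    qed
    from this[of i j] this[of j i] that show ?thesis
      by (cases i j rule: linorder_cases) auto
  qed
  have reduce: "?w (j - i) = v" if "?w i = ?w j" "i < j" for i j
  proof -
    have "even (j - i)" using same_parity[OF that(1)] that by simp
    then obtain d where "j - i = 2 * d" by (elim evenE)
    with that have "j = i + 2 * d" by auto
    with that walk_even_collision[OF wV, of i d] show ?thesis by simp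
  qed
  have ex: "\<exists>k. k > 0 \<and> ?w k = v"
  proof -
    obtain i j where ij: "?w i = ?w j" "i < j"
      using finite_range_collision[OF finC wC] by blast
    then show ?thesis using reduce by (intro exI[of _ "j - i"]) auto
  qed
  define m where "m = (LEAST k. k > 0 \<and> ?w k = v)"
  have m: "m > 0" "?w m = v" using LeastI_ex[OF ex] unfolding m_def by auto
  have least: "?w k \<noteq> v" if "0 < k" "k < m" for k
    using not_less_Least that unfolding m_def by blast
  have evm: "even m" using same_parity[of m 0] m by simp
  have inj: "i = j" if "?w i = ?w j" "i < m" "j < m" for i j
    using reduce[of i j] reduce[of j i] least[of "i - j"] least[of "j - i"] that
    by (cases i j rule: linorder_cases) auto
  have wmod: "?w (Suc i) = ?w (Suc i mod m)" if "i < m" for i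
    using that m by (cases "Suc i = m") auto
  have pre: "\<exists>k<m. step i (?w j) = ?w k \<and> (\<exists>k<m. edge i (?w j) = edge k (?w k))"
    if "j < m" for i j
  proof (cases "even (i + j)")
    case True
    then have st: "step i (?w j) = ?w (Suc j)" using step_cong[of i j] by (simp add: walk.simps(2))
    have "edge i (?w j) = edge j (?w j)" by (rule edge_cong[OF True])
    moreover have "Suc j mod m < m" using m by simp
    ultimately show ?thesis using st wmod[OF that] that by metis
  next
    case False
    \<comment> \<open>The predecessor of position 0 is \<open>m - 1\<close>, as the walk closes up;
      the parity is right because \<open>m\<close> is even.\<close>
    define j' where "j' = (if j = 0 then m - 1 else j - 1)"
    have j': "j' < m" "?w j = ?w (Suc j')" "even (i + j')"
      using False that m evm by (auto simp: j'_def)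
    have "step i (?w j) = ?w j'"
      using step_cong[OF j'(3)] walk_back[OF wV, of j'] j' by simp
    moreover have "edge i (?w j) = edge j' (?w j')"
      using edge_cong[OF j'(3)] edge_step[OF wV[of j'], of j'] j'
      by (simp add: walk.simps(2))
    ultimately show ?thesis using j'(1) by (intro exI[of _ j'] conjI) simp_all
  qed
  have Cw: "C = ?w ` {..<m}"
  proof
    show "C \<subseteq> ?w ` {..<m}"
    proof (rule comps_least[OF C v])
      show "v \<in> ?w ` {..<m}" using m by (intro image_eqI[of _ _ 0]) auto
      show "step i x \<in> ?w ` {..<m}" if "x \<in> ?w ` {..<m}" for x i
        using that pre by blast
    qed
  qed (use wC in auto)
  have m2: "m \<ge> 2" using evm m(1) by presburger
  define vs where "vs = map ?w [0..<m]"
  define es where "es = map (\<lambda>i. edge i (?w i)) [0..<m]"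
  show "is_cycle E meander_ends C"
    unfolding is_cycle_def
  proof (intro exI[of _ vs] exI[of _ es] conjI)
    show "distinct vs"
      unfolding vs_def distinct_map by (auto simp: inj_on_def intro: inj)
    show "set vs = C" unfolding vs_def Cw by auto
    show "distinct es"
      unfolding es_def distinct_map
    proof (intro conjI inj_onI)
      fix i j assume ij: "i \<in> set [0..<m]" "j \<in> set [0..<m]" "edge i (?w i) = edge j (?w j)"
      with edge_eqD[OF ij(3)] have "even (i + j)" "?w i = ?w j \<or> ?w i = ?w (Suc j)"
        by (auto simp: walk.simps(2))
      with ij inj[of i j] same_parity[of i "Suc j"] show "i = j" by auto
    qed simp
    show "set es = induced_edges E meander_ends C"
    proof
      show "set es \<subseteq> induced_edges E meander_ends C"
      proof
        fix e assume "e \<in> set es"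
        then obtain i where i: "i < m" "e = edge i (?w i)" by (auto simp: es_def)
        with no'[of i] wV[of i] have "e \<in> E"
          unfolding mem_E_iff by (intro exI[of _ "?w i"] exI[of _ i]) (simp add: walk.simps(2))
        then show "e \<in> induced_edges E meander_ends C"
          unfolding induced_edges_def using i wC[of i] wC[of "Suc i"] by (auto simp: walk.simps(2))
      qed
      show "induced_edges E meander_ends C \<subseteq> set es"
      proof
        fix e assume "e \<in> induced_edges E meander_ends C"
        then obtain a i where a: "e = edge i a" "a \<in> C"
          unfolding induced_edges_def mem_E_iff by auto
        then obtain j where "j < m" "a = ?w j" unfolding Cw by auto
        with pre[of j i] a show "e \<in> set es" unfolding es_def by auto
      qed
    qed
    show "length vs = length es" "2 \<le> length es" using m2 by (simp_all add: vs_def es_def)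
    show "\<forall>i<length es. meander_ends (es ! i) = {vs ! i, vs ! ((i + 1) mod length es)}"
      using wmod m by (auto simp: vs_def es_def walk.simps(2)[symmetric, where s = 0, simplified])
  qed
  let ?c = "\<lambda>x. orbit_rel V q `` {x}"
  have "?c ` C \<subseteq> {?c v, ?c (?w 1)}"
  proof
    fix X assume "X \<in> ?c ` C"
    then obtain i where X: "X = ?c (?w i)" unfolding Cw by auto
    show "X \<in> {?c v, ?c (?w 1)}"
    proof (cases "even i")
      case True
      then show ?thesis
        using walk_orbit_rel_even[OF wV, of 0 "i div 2"] X by (auto simp: orbit_rel_class_eq orbit_rel_sym)
    next
      case False
      then have "1 + 2 * (i div 2) = i" by simp
      then show ?thesis
        using walk_orbit_rel_even[OF wV, of 1 "i div 2"] X
        by (metis insertCI orbit_rel_class_eq)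
    qed
  qed
  moreover have "?c v \<in> ?c ` C" "?c (?w 1) \<in> ?c ` C" using v wC[of 1] by blast+
  moreover have "?c v \<noteq> ?c (?w 1)"
  proof
    assume "?c v = ?c (?w 1)"
    then have rel: "(v, ?w 1) \<in> orbit_rel V q" by (simp only: orbit_rel_class_eq)
    \<comment> \<open>The walk starts on the lower side, so \<open>q\<close> moves an even position
      two places forward. The even positions are therefore closed under \<open>q\<close> in both
      directions, while position 1 is not among them.\<close>
    define S where "S = {?w i | i. even i}"
    have "?w 1 \<in> S"
    proof (rule orbit_rel_invariant[OF rel])
      show "v \<in> S" unfolding S_def by (rule CollectI, rule exI[of _ 0]) simp
      fix x assume x: "x \<in> V"
      show "x \<in> S \<longleftrightarrow> q x \<in> S"
      proof
        assume "x \<in> S"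
        then obtain i where "x = ?w i" "even i" by (auto simp: S_def)
        then have "q x = ?w (Suc (Suc i))" by (simp add: walk.simps(2) step_def)
        with \<open>even i\<close> show "q x \<in> S" unfolding S_def by (intro CollectI exI[of _ "Suc (Suc i)"]) simp
      next
        assume "q x \<in> S"
        then obtain i where i: "q x = ?w i" "even i" by (auto simp: S_def)
        \<comment> \<open>Position 0 is read as position \<open>m\<close>, so that two places can be
          subtracted.\<close>
        then obtain k where k: "q x = ?w (Suc (Suc k))" "even k"
        proof (cases "i = 0")
          case True
          then have "q x = ?w (Suc (Suc (m - 2)))" using i m m2
            by (metis add_2_eq_Suc le_add_diff_inverse walk.simps(1))
          then show ?thesis using that[of "m - 2"] evm by simp
        next
          case False
          then have "Suc (Suc (i - 2)) = i" using i(2) by (cases i) auto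
          then show ?thesis using that[of "i - 2"] i by simp
        qed
        then have "q x = q (?w k)" by (simp add: walk.simps(2) step_def)
        then have "l (u (q x)) = l (u (q (?w k)))" by simp
        then have "x = ?w k" using x wV[of k] by (simp add: u_u l_l l_in)
        then show "x \<in> S" using k unfolding S_def by blast
      qed
    qed
    then obtain i where "?w 1 = ?w i" "even i" by (auto simp: S_def)
    then show False using same_parity[of 1 i] by simp
  qed
  ultimately have "?c ` C = {?c v, ?c (?w 1)}" by blast
  with \<open>?c v \<noteq> ?c (?w 1)\<close> show "card (?c ` C) = 2" by simp
qed

section \<open>Counting orbits component by component\<close>

text \<open>A path has one vertex more than it has edges, a cycle equally many.\<close>

lemma not_path_and_cycle:
  "is_path E meander_ends C \<Longrightarrow> \<not> is_cycle E meander_ends C"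
proof
  assume "is_path E meander_ends C" "is_cycle E meander_ends C"
  then have "card C = card (induced_edges E meander_ends C) + 1"
    "card C = card (induced_edges E meander_ends C)"
    unfolding is_path_def is_cycle_def by (metis distinct_card)+
  then show False by simp
qed

text \<open>Every orbit of \<open>q\<close> lies in one component. A component with a vertex fixed
  on some side is a path and a single orbit; any other is a cycle and consists of two
  orbits.\<close>

theorem index_eq_num_orbits:
  "2 * card {C \<in> comps. is_cycle E meander_ends C} + card {C \<in> comps. is_path E meander_ends C} =
    num_orbits V q"
proof -
  let ?c = "\<lambda>x. orbit_rel V q `` {x}"
  let ?cyc = "{C \<in> comps. is_cycle E meander_ends C}"
  let ?path = "{C \<in> comps. is_path E meander_ends C}"
  have path: "card (?c ` C) = 1"
    and cyc: "\<not> is_cycle E meander_ends C \<Longrightarrow> is_path E meander_ends C"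
    if C: "C \<in> comps" "\<not> is_cycle E meander_ends C" for C
  proof -
    obtain v i where v: "v \<in> C" "step i v = v"
      using no_fixed_point_cycle(1)[OF C(1)] C(2) by blast
    \<comment> \<open>The shift by 2 keeps the side and brings the equation to the form
      \<open>step (Suc s) v = v\<close> with \<open>s = Suc i\<close>.\<close>
    then have fixed: "step (Suc (Suc i)) v = v"
      using step_cong[of "Suc (Suc i)" i] by simp
    note * = fixed_point_path[OF C(1) v(1) fixed]
    show "is_path E meander_ends C" by (rule *)
    have "?c ` C = (\<lambda>_. ?c v) ` C"
      by (rule image_cong[OF refl]) (simp only: orbit_rel_class_eq *(2) v(1))
    also have "\<dots> = {?c v}" by (rule image_constant[OF v(1)])
    finally have "?c ` C = {?c v}" .
    then show "card (?c ` C) = 1" by simp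
  qed
  have cycle: "card (?c ` C) = 2" if "C \<in> comps" "is_cycle E meander_ends C" for C
  proof (rule no_fixed_point_cycle(2)[OF that(1)])
    fix v i assume v: "v \<in> C" 
    show "step i v \<noteq> v"
    proof
      assume "step i v = v"
      then have fixed: "step (Suc (Suc i)) v = v"
        using step_cong[of "Suc (Suc i)" i] by simp
      from fixed_point_path(1)[OF that(1) v fixed] not_path_and_cycle that(2) show False by blast
    qed
  qed
  have fin_comps: "finite comps" using fin by (simp add: comps_eq)
  have fin_C: "finite C" if "C \<in> comps" for C
    using comps_sub[OF that] fin by (rule finite_subset)
  have sub: "?c x \<subseteq> C" if "C \<in> comps" "x \<in> C" for C x
  proof
    fix y assume "y \<in> ?c x"
    then have "(x, y) \<in> orbit_rel V q" by simp
    then show "y \<in> C"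
    proof (rule orbit_rel_invariant[OF _ that(2)])
      fix z assume z: "z \<in> V"
      have *: "step 1 (step 0 a) \<in> C" "step 0 (step 1 a) \<in> C" if "a \<in> C" for a
        using that \<open>C \<in> comps\<close> by (blast intro: comps_step)+
      show "z \<in> C \<longleftrightarrow> q z \<in> C"
        using *(1)[of z] *(2)[of "q z"] z by (auto simp: step_def u_u l_l l_in)
    qed
  qed
  have disj: "C = C'" if "C \<in> comps" "C' \<in> comps" "?c ` C \<inter> ?c ` C' \<noteq> {}" for C C'
  proof -
    from that(3) obtain a b where ab: "a \<in> C" "b \<in> C'" "?c a = ?c b" by blast
    have "a \<in> ?c a" by simp
    then have "a \<in> C'" using sub[OF that(2) ab(2)] ab(3) by blast
    then show ?thesis using comps_class[OF that(1) ab(1)] comps_class[OF that(2), of a] by blast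
  qed
  have "\<Union> comps = V" using comps_sub by (auto simp: comps_eq)
  then have "?c ` V = (\<Union>C\<in>comps. ?c ` C)" by blast
  then have "num_orbits V q = card (\<Union>C\<in>comps. ?c ` C)"
    by (simp add: num_orbits_def)
  also have "\<dots> = (\<Sum>C\<in>comps. card (?c ` C))"
  proof (rule card_UN_disjoint[OF fin_comps])
    show "\<forall>C\<in>comps. finite (?c ` C)" using fin_C by blast
    show "\<forall>C\<in>comps. \<forall>C'\<in>comps. C \<noteq> C' \<longrightarrow> ?c ` C \<inter> ?c ` C' = {}" using disj by blast
  qed
  also have "\<dots> = (\<Sum>C\<in>?cyc. card (?c ` C)) + (\<Sum>C\<in>comps - ?cyc. card (?c ` C))"
    using sum.subset_diff[OF _ fin_comps, of ?cyc "\<lambda>C. card (?c ` C)"] by simp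
  also have "(\<Sum>C\<in>?cyc. card (?c ` C)) = 2 * card ?cyc"
    using cycle by simp
  also have "comps - ?cyc = ?path"
    using cyc not_path_and_cycle by blast
  also have "(\<Sum>C\<in>?path. card (?c ` C)) = card ?path"
    using path not_path_and_cycle by simp
  finally show ?thesis by simp
qed

end


section \<open>The index of a meander\<close>

text \<open>Positions are counted from 0 here, but from 1 in \<open>arcs_of\<close>.\<close>

fun flip :: "nat list \<Rightarrow> nat \<Rightarrow> nat" where
  "flip [] v = v"
| "flip (a # L) v = (if v < a then a - 1 - v else a + flip L (v - a))"

lemma flip_less: "v < sum_list L \<Longrightarrow> flip L v < sum_list L"
  by (induction L v rule: flip.induct) auto

lemma flip_flip: "flip L (flip L v) = v"
  by (induction L v rule: flip.induct) auto

lemma arcs_ofI: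
  assumes "j < length L" "1 \<le> i" "i \<le> L ! j div 2"
  shows "{sum_list (take j L) + i, sum_list (take j L) + L ! j + 1 - i} \<in> arcs_of L"
  using assms unfolding arcs_of_def by blast

section \<open>Arcs of a composition as edges of its reversal\<close>

lemma arcs_of_Cons:
  "arcs_of (a # L) = (\<lambda>i. {i, a + 1 - i}) ` {1..a div 2} \<union> (`) ((+) a) ` arcs_of L"
  (is "?l = ?r")
proof
  show "?l \<subseteq> ?r"
  proof
    fix e assume "e \<in> ?l"
    then obtain j i where j: "j < length (a # L)" and i: "1 \<le> i" "i \<le> (a # L) ! j div 2"
      and e: "e = {sum_list (take j (a # L)) + i, sum_list (take j (a # L)) + (a # L) ! j + 1 - i}"
      unfolding arcs_of_def by blast
    show "e \<in> ?r"
    proof (cases j)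
      case 0
      with i e show ?thesis by auto
    next
      case (Suc k)
      have "e = (+) a ` {sum_list (take k L) + i, sum_list (take k L) + L ! k + 1 - i}"
        using i Suc unfolding e by auto
      moreover have "{sum_list (take k L) + i, sum_list (take k L) + L ! k + 1 - i} \<in> arcs_of L"
        by (rule arcs_ofI) (use i j Suc in auto)
      ultimately show ?thesis by blast
    qed
  qed
  show "?r \<subseteq> ?l"
  proof
    fix e assume "e \<in> ?r"
    then consider i where "i \<in> {1..a div 2}" "e = {i, a + 1 - i}"
      | e' where "e' \<in> arcs_of L" "e = (+) a ` e'" by blast
    then show "e \<in> ?l"
    proof cases
      case 1
      then show ?thesis using arcs_ofI[of 0 "a # L" i] by simp
    next
      case 2
      then obtain j i where j: "j < length L" and i: "1 \<le> i" "i \<le> L ! j div 2"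
        and e': "e' = {sum_list (take j L) + i, sum_list (take j L) + L ! j + 1 - i}"
        unfolding arcs_of_def by blast
      have "e = {sum_list (take (Suc j) (a # L)) + i,
          sum_list (take (Suc j) (a # L)) + (a # L) ! Suc j + 1 - i}"
        using i unfolding 2 e' by auto
      also have "\<dots> \<in> arcs_of (a # L)"
        by (rule arcs_ofI) (use i j in auto)
      finally show ?thesis .
    qed
  qed
qed

lemma involution_edgesI: "v \<in> V \<Longrightarrow> f v \<noteq> v \<Longrightarrow> {v, f v} \<in> involution_edges V f"
  by (auto simp: involution_edges_def)

text \<open>\<open>arcs_of\<close> names each arc once, by its left end, while
  \<open>involution_edges\<close> names it from both ends; as sets of unordered pairs they agree.
  The middle of an odd part is fixed and yields no edge.\<close>

lemma arcs_of_eq_involution_edges: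
  "arcs_of L = involution_edges {1..sum_list L} (\<lambda>v. Suc (flip L (v - 1)))"
proof (induction L)
  case Nil
  then show ?case by (simp add: arcs_of_def involution_edges_def)
next
  case (Cons a L)
  let ?f = "\<lambda>L v. Suc (flip L (v - 1))"
  have reversal: "?f (a # L) v = a + 1 - v" if "v \<in> {1..a}" for v
    using that by auto
  have "involution_edges {1..sum_list (a # L)} (?f (a # L)) =
      involution_edges {1..a} (?f (a # L)) \<union> involution_edges ((+) a ` {1..sum_list L}) (?f (a # L))"
  proof -
    have "{1..sum_list (a # L)} = {1..a} \<union> (+) a ` {1..sum_list L}"
      by auto
    then show ?thesis by (auto simp: involution_edges_def)
  qed
  also have "involution_edges {1..a} (?f (a # L)) = (\<lambda>i. {i, a + 1 - i}) ` {1..a div 2}" (is "?l = ?r")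
  proof
    show "?l \<subseteq> ?r"
    proof
      fix e assume "e \<in> ?l"
      then obtain v where "v \<in> {1..a}" "e = {v, ?f (a # L) v}" "?f (a # L) v \<noteq> v"
        unfolding involution_edges_def by blast
      then have v: "1 \<le> v" "v \<le> a" "e = {v, a + 1 - v}" "a + 1 - v \<noteq> v"
        using reversal by auto
      show "e \<in> ?r"
      proof (cases "v \<le> a div 2")
        case False
        \<comment> \<open>A vertex in the right half is replaced by its mirror image, which names
          the same arc.\<close>
        with v show ?thesis by (intro image_eqI[of _ _ "a + 1 - v"]) auto
      qed (use v in auto)
    qed
    show "?r \<subseteq> ?l"
    proof
      fix e assume "e \<in> ?r"
      then obtain i where "i \<in> {1..a div 2}" and i: "e = {i, a + 1 - i}" by blast
      then have i: "1 \<le> i" "i \<le> a div 2" "e = {i, a + 1 - i}" by simp_all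
      have f: "?f (a # L) i = a + 1 - i" by (rule reversal) (use i in auto)
      have "{i, ?f (a # L) i} \<in> ?l"
        by (rule involution_edgesI) (unfold f, use i in auto)
      then show "e \<in> ?l" unfolding f i(3) .
    qed
  qed
  also have "involution_edges ((+) a ` {1..sum_list L}) (?f (a # L)) = (`) ((+) a) ` arcs_of L"
  proof -
    have f: "?f (a # L) (a + v) = a + ?f L v" if "v \<ge> 1" for v
      using that by auto
    show ?thesis unfolding Cons.IH
    proof (intro equalityI subsetI)
      fix e assume "e \<in> involution_edges ((+) a ` {1..sum_list L}) (?f (a # L))"
      then obtain v where v: "v \<in> {1..sum_list L}" "?f (a # L) (a + v) \<noteq> a + v"
        "e = {a + v, ?f (a # L) (a + v)}" unfolding involution_edges_def by blast
      then have "{v, ?f L v} \<in> involution_edges {1..sum_list L} (?f L)" "e = (+) a ` {v, ?f L v}"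
        using f[of v] unfolding involution_edges_def by auto
      then show "e \<in> (`) ((+) a) ` involution_edges {1..sum_list L} (?f L)" by blast
    next
      fix e assume "e \<in> (`) ((+) a) ` involution_edges {1..sum_list L} (?f L)"
      then obtain v where v: "v \<in> {1..sum_list L}" "?f L v \<noteq> v" "e = (+) a ` {v, ?f L v}"
        unfolding involution_edges_def by blast
      with f[of v] show "e \<in> involution_edges ((+) a ` {1..sum_list L}) (?f (a # L))"
        unfolding involution_edges_def by (intro CollectI exI[of _ "a + v"]) simp
    qed
  qed
  finally show ?case by (simp only: arcs_of_Cons)
qed

section \<open>The index as the number of orbits of two composed reversals\<close>

definition flip_index :: "nat list \<Rightarrow> nat list \<Rightarrow> nat" where
  "flip_index L M = num_orbits {0..<sum_list L} (\<lambda>v. flip L (flip M v))"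

lemma meander_index_eq_flip_index:
  assumes "sum_list L = sum_list M"
  shows "meander_index (L, M) = flip_index L M"
proof -
  let ?V = "{1..sum_list L}"
  interpret two_involutions ?V "\<lambda>v. Suc (flip L (v - 1))" "\<lambda>v. Suc (flip M (v - 1))"
  proof
    fix v assume "v \<in> ?V"
    then show "Suc (flip L (v - 1)) \<in> ?V" "Suc (flip M (v - 1)) \<in> ?V"
      using flip_less[of "v - 1" L] flip_less[of "v - 1" M] assms by (auto simp: Suc_le_eq)
    from \<open>v \<in> ?V\<close> show "Suc (flip L (Suc (flip L (v - 1)) - 1)) = v"
      "Suc (flip M (Suc (flip M (v - 1)) - 1)) = v"
      by (simp_all add: flip_flip)
  qed simp
  have E: "meander_edges (L, M) = E"
    unfolding meander_edges_def E_def arcs_of_eq_involution_edges by (simp add: assms)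
  have "meander_index (L, M) = num_orbits ?V q"
    unfolding meander_index_def meander_components_def E using index_eq_num_orbits by simp
  also have "\<dots> = flip_index L M"
    unfolding flip_index_def
  proof (rule num_orbits_bij[where f = "\<lambda>v. v - 1" and g = Suc])
    show "q v \<in> ?V" if "v \<in> ?V" for v using that by (intro u_in l_in)
  qed auto
  finally show ?thesis .
qed

lemma flip_flip_less:
  "sum_list L = sum_list M \<Longrightarrow> v < sum_list L \<Longrightarrow> flip L (flip M v) < sum_list L"
  by (metis flip_less)

text \<open>The two orders of composing the reversals give inverse permutations.\<close>

lemma flip_index_sym:
  assumes "sum_list L = sum_list M"
  shows "flip_index L M = flip_index M L"
  unfolding flip_index_def assms
  by (rule num_orbits_inverse) (use assms flip_flip_less[of L M] flip_flip_less[of M L] in \<open>auto simp: flip_flip\<close>)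

text \<open>Equal reversals cancel on the first \<open>a\<close> vertices, which become
  \<open>a\<close> one-point orbits; the rest is a shifted copy of the smaller meander.\<close>

lemma flip_index_Cons_same:
  assumes "sum_list L = sum_list M"
  shows "flip_index (a # L) (a # M) = a + flip_index L M"
proof -
  let ?p = "\<lambda>v. flip (a # L) (flip (a # M) v)"
  let ?n = "sum_list L"
  have less: "flip L (flip M v) < ?n" if "v < ?n" for v
    using flip_flip_less[OF assms that] .
  have V: "{0..<sum_list (a # L)} = {0..<a} \<union> {a..<a + ?n}"
    by (simp add: ivl_disj_un_two(3))
  have "flip_index (a # L) (a # M) = num_orbits ({0..<a} \<union> {a..<a + ?n}) ?p"
    unfolding flip_index_def V ..
  also have "\<dots> = num_orbits {0..<a} ?p + num_orbits {a..<a + ?n} ?p"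
  proof (rule num_orbits_Un)
    show "?p v \<in> {a..<a + ?n}" if "v \<in> {a..<a + ?n}" for v
      using that less[of "v - a"] by auto
  qed auto
  also have "num_orbits {0..<a} ?p = a"
    by (subst num_orbits_identity) auto
  also have "num_orbits {a..<a + ?n} ?p = flip_index L M"
    unfolding flip_index_def
  proof (rule num_orbits_bij[where f = "\<lambda>v. v - a" and g = "\<lambda>v. v + a"])
    show "?p v \<in> {a..<a + ?n}" if "v \<in> {a..<a + ?n}" for v
      using that less[of "v - a"] by auto
  qed auto
  finally show ?thesis .
qed

section \<open>Deleting one vertex\<close>

text \<open>Instances of Panyushev's reduction. In each case a vertex fixed by one of the two reversals and
  moved by the other is deleted from its orbit: vertex 0, or vertex 1 for the parts 2 and 3.\<close>

lemma flip_index_1_2: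
  assumes "1 + sum_list L = 2 + sum_list M"
  shows "flip_index (1 # L) (2 # M) = flip_index L (1 # M)"
proof -
  let ?p = "\<lambda>v. flip (1 # L) (flip (2 # M) v)" and ?V = "{0..<sum_list (1 # L)}"
  have pV: "?p v \<in> ?V" if "v \<in> ?V" for v
    using that flip_flip_less[of "1 # L" "2 # M" v] assms by simp
  have "flip_index (1 # L) (2 # M) =
      num_orbits (?V - {0}) (\<lambda>v. if ?p v = 0 then ?p 0 else ?p v)"
    unfolding flip_index_def by (rule num_orbits_remove_point) (use pV in auto)
  also have "\<dots> = flip_index L (1 # M)"
    unfolding flip_index_def
  proof (rule num_orbits_bij[where f = "\<lambda>v. v - 1" and g = Suc])
    show "(if ?p v = 0 then ?p 0 else ?p v) \<in> ?V - {0}" if "v \<in> ?V - {0}" for v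
      using pV[of v] pV[of 0] that by auto
    show "(if ?p v = 0 then ?p 0 else ?p v) - 1 = flip L (flip (1 # M) (v - 1))"
      if "v \<in> ?V - {0}" for v
    proof -
      \<comment> \<open>Only vertex 1 is sent to the deleted vertex 0; what remains of the part 2 is
        a part 1.\<close>
      have "v = 1 \<or> v \<ge> 2" using that by auto
      then show ?thesis by (auto simp: numeral_2_eq_2 Suc_diff_Suc)
    qed
  qed auto
  finally show ?thesis .
qed

lemma flip_index_1_3:
  assumes "1 + sum_list L = 3 + sum_list M"
  shows "flip_index (1 # L) (3 # M) = flip_index L (1 # 1 # M)"
proof -
  let ?p = "\<lambda>v. flip (1 # L) (flip (3 # M) v)" and ?V = "{0..<sum_list (1 # L)}"
  have pV: "?p v \<in> ?V" if "v \<in> ?V" for v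
    using that flip_flip_less[of "1 # L" "3 # M" v] assms by simp
  have "flip_index (1 # L) (3 # M) =
      num_orbits (?V - {0}) (\<lambda>v. if ?p v = 0 then ?p 0 else ?p v)"
    unfolding flip_index_def by (rule num_orbits_remove_point) (use pV in auto)
  also have "\<dots> = flip_index L (1 # 1 # M)"
    unfolding flip_index_def
  proof (rule num_orbits_bij[where f = "\<lambda>v. v - 1" and g = Suc])
    show "(if ?p v = 0 then ?p 0 else ?p v) \<in> ?V - {0}" if "v \<in> ?V - {0}" for v
      using pV[of v] pV[of 0] that by auto
    show "(if ?p v = 0 then ?p 0 else ?p v) - 1 = flip L (flip (1 # 1 # M) (v - 1))"
      if "v \<in> ?V - {0}" for v
    proof -
      \<comment> \<open>Vertices 1 and 2, the middle and right end of the part 3, both become parts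
        1.\<close>
      have "v = 1 \<or> v = 2 \<or> v \<ge> 3" using that by auto
      then show ?thesis by (auto simp: numeral_2_eq_2 numeral_3_eq_3 Suc_diff_Suc)
    qed
  qed auto
  finally show ?thesis .
qed

lemma flip_index_2_3:
  assumes "2 + sum_list L = 3 + sum_list M"
  shows "flip_index (2 # L) (3 # M) = flip_index (1 # L) (2 # M)"
proof -
  let ?p = "\<lambda>v. flip (2 # L) (flip (3 # M) v)" and ?V = "{0..<sum_list (2 # L)}"
  have pV: "?p v \<in> ?V" if "v \<in> ?V" for v
    using that flip_flip_less[of "2 # L" "3 # M" v] assms by simp
  have "flip_index (2 # L) (3 # M) =
      num_orbits (?V - {1}) (\<lambda>v. if ?p v = 1 then ?p 1 else ?p v)"
    unfolding flip_index_def by (rule num_orbits_remove_point) (use pV in auto)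
  also have "\<dots> = flip_index (1 # L) (2 # M)"
    unfolding flip_index_def
  \<comment> \<open>Truncated subtraction keeps vertex 0 in place and closes the gap left by vertex
    1.\<close>
  proof (rule num_orbits_bij[where f = "\<lambda>v. v - 1" and g = "\<lambda>v. if v = 0 then 0 else Suc v"])
    show "(if ?p v = 1 then ?p 1 else ?p v) \<in> ?V - {1}" if "v \<in> ?V - {1}" for v
      using pV[of v] pV[of 1] that by auto
    show "(if ?p v = 1 then ?p 1 else ?p v) - 1 = flip (1 # L) (flip (2 # M) (v - 1))"
      if "v \<in> ?V - {1}" for v
    proof -
      have "v = 0 \<or> v = 2 \<or> v \<ge> 3" using that by auto
      then show ?thesis by (auto simp: numeral_2_eq_2 numeral_3_eq_3 Suc_diff_Suc)
    qed
  qed auto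
  finally show ?thesis .
qed

section \<open>Scaling all parts by a constant\<close>

text \<open>A position is written as block \<open>v\<close> and offset \<open>i\<close> inside a
  block of length \<open>c\<close>. Reversing a scaled part reverses the order of its blocks and the
  offset within each block.\<close>

lemma flip_map_times:
  "v < sum_list L \<Longrightarrow> i < c \<Longrightarrow> flip (map ((*) c) L) (c * v + i) = c * flip L v + (c - 1 - i)"
proof (induction L v rule: flip.induct)
  case (2 a L v)
  show ?case
  proof (cases "v < a")
    case True
    then obtain d where d: "a = v + d + 1" by (metis add.commute less_imp_Suc_add plus_1_eq_Suc)
    have ca: "c * a = c * v + c * d + c" unfolding d by (simp only: distrib_left mult_1_right)
    have "c * v + i < c * a" unfolding ca using \<open>i < c\<close> by linarith
    moreover have "c * a - 1 - (c * v + i) = c * d + (c - 1 - i)"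
      unfolding ca using \<open>i < c\<close> by linarith
    ultimately show ?thesis using True d by simp
  next
    case False
    then obtain d where d: "v = a + d" using le_Suc_ex not_less by blast
    with 2 False show ?thesis by (simp add: algebra_simps)
  qed
qed simp

text \<open>Composing two reversals restores the position inside a block of length \<open>c\<close>, so the scaled
  meander has \<open>c\<close> copies of every orbit.\<close>

lemma flip_index_map_times:
  assumes "sum_list L = sum_list M"
  shows "flip_index (map ((*) c) L) (map ((*) c) M) = c * flip_index L M"
proof -
  let ?n = "sum_list L"
  let ?p = "\<lambda>v. flip (map ((*) c) L) (flip (map ((*) c) M) v)"
  let ?q = "\<lambda>v. flip L (flip M v)"
  let ?B = "\<lambda>i. (\<lambda>v. c * v + i) ` {0..<?n}"
  have p: "?p (c * v + i) = c * ?q v + i" if "v < ?n" "i < c" for v i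
    using that assms flip_map_times[of v M i c] flip_map_times[of "flip M v" L "c - 1 - i" c]
      flip_less[of v M] by simp
  have q: "?q v < ?n" if "v < ?n" for v
    using flip_flip_less[OF assms that] .
  have pB: "?p x \<in> ?B i" if "x \<in> ?B i" "i < c" for x i
    using that p q by auto
  have B: "num_orbits (?B i) ?p = flip_index L M" if "i < c" for i
    unfolding flip_index_def
    by (rule num_orbits_bij[where f = "\<lambda>x. x div c" and g = "\<lambda>v. c * v + i"])
      (use that p q in auto)
  \<comment> \<open>The residue classes modulo \<open>c\<close> are invariant and are added one at a
    time.\<close>
  have "num_orbits (\<Union>i<k. ?B i) ?p = k * flip_index L M" if "k \<le> c" for k
    using that
  proof (induction k)
    case 0
    then show ?case by (simp add: num_orbits_def)
  next
    case (Suc k)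
    have "num_orbits ((\<Union>i<k. ?B i) \<union> ?B k) ?p = num_orbits (\<Union>i<k. ?B i) ?p + num_orbits (?B k) ?p"
    proof (rule num_orbits_Un)
      show "(\<Union>i<k. ?B i) \<inter> ?B k = {}"
      proof -
        have "x mod c < k" if "x \<in> (\<Union>i<k. ?B i)" for x using that Suc.prems by auto
        moreover have "x mod c = k" if "x \<in> ?B k" for x using that Suc.prems by auto
        ultimately show ?thesis by fastforce
      qed
      show "?p x \<in> (\<Union>i<k. ?B i)" if "x \<in> (\<Union>i<k. ?B i)" for x
      proof -
        from that obtain i where i: "i < k" "x \<in> ?B i" by blast
        then have "?p x \<in> ?B i" using Suc.prems by (intro pB) auto
        with i(1) show ?thesis by blast
      qed
      show "?p x \<in> ?B k" if "x \<in> ?B k" for x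
        by (rule pB[OF that]) (use Suc.prems in simp)
    qed simp_all
    moreover have "(\<Union>i<Suc k. ?B i) = (\<Union>i<k. ?B i) \<union> ?B k"
      by (auto simp: lessThan_Suc)
    ultimately show ?case using Suc B[of k] by simp
  qed
  from this[of c] have "num_orbits (\<Union>i<c. ?B i) ?p = c * flip_index L M" by simp
  moreover have "(\<Union>i<c. ?B i) = {0..<sum_list (map ((*) c) L)}"
  proof (intro equalityI subsetI)
    fix x assume "x \<in> {0..<sum_list (map ((*) c) L)}"
    then have "x < c * ?n" by (simp add: sum_list_const_mult)
    moreover from this have "c > 0" by (cases c) auto
    ultimately have "x div c < ?n" "x mod c < c"
      by (simp_all add: less_mult_imp_div_less mult.commute)
    then show "x \<in> (\<Union>i<c. ?B i)"
      by (intro UN_I[of "x mod c"] image_eqI[of _ _ "x div c"]) simp_all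
  next
    fix x assume "x \<in> (\<Union>i<c. ?B i)"
    then obtain v i where x: "x = c * v + i" "v < ?n" "i < c" by auto
    then have "c * v + i < c * Suc v" by simp
    also have "\<dots> \<le> c * ?n" using x(2) by (intro mult_le_mono) auto
    finally show "x \<in> {0..<sum_list (map ((*) c) L)}" using x(1) by (simp add: sum_list_const_mult)
  qed
  ultimately show ?thesis by (simp only: flip_index_def)
qed


section \<open>Generating functions\<close>

definition admissible :: "nat set \<Rightarrow> nat \<Rightarrow> nat \<Rightarrow> (nat list \<times> nat list) set" where
  "admissible J n k =
    {M. meander n M \<and> set (fst M) \<subseteq> J \<and> set (snd M) \<subseteq> J \<and> meander_index M = k}"

lemma meander_index_map_times:
  assumes "meander n (L, M)"
  shows "meander_index (map ((*) c) L, map ((*) c) M) = c * meander_index (L, M)"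
proof -
  have "sum_list L = sum_list M" using assms by (simp add: meander_def composition_def)
  then show ?thesis
    by (simp add: meander_index_eq_flip_index flip_index_map_times sum_list_const_mult)
qed

lemma meander_count_times:
  assumes "c \<ge> 1"
  shows "meander_count ((*) c ` J) n k =
    (if c dvd n \<and> c dvd k then meander_count J (n div c) (k div c) else 0)"
proof -
  let ?h = "map_prod (map ((*) c)) (map ((*) c))"
  have c: "c > 0" using assms by simp
  have comp: "composition (c * n) (map ((*) c) L) \<longleftrightarrow> composition n L" for n L
    using c by (simp add: composition_def sum_list_const_mult)
  have sub: "set (map ((*) c) L) \<subseteq> (*) c ` J \<longleftrightarrow> set L \<subseteq> J" for L
    using c by (auto simp: inj_image_subset_iff inj_on_def)
  have h: "?h M \<in> admissible ((*) c ` J) (c * n) (c * k) \<longleftrightarrow> M \<in> admissible J n k" for M n k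
  proof (cases "meander n M")
    case True
    then show ?thesis using c sub meander_index_map_times[of n "fst M" "snd M" c]
      by (simp add: admissible_def meander_def comp map_prod_def split_beta)
  next
    case False
    then show ?thesis by (auto simp: admissible_def meander_def comp map_prod_def split_beta)
  qed
  have ex: "\<exists>M' n' k'. M = ?h M' \<and> n = c * n' \<and> k = c * k'" if "M \<in> admissible ((*) c ` J) n k" for M
  proof -
    obtain L1 L2 where M: "M = (L1, L2)" by fastforce
    have "L1 \<in> lists ((*) c ` J)" "L2 \<in> lists ((*) c ` J)" "meander n M" "meander_index M = k"
      using that M by (auto simp: admissible_def)
    then obtain L1' L2' where L: "L1 = map ((*) c) L1'" "L2 = map ((*) c) L2'"
      by (auto simp: lists_image)
    have n: "n = c * sum_list L1'"
      using \<open>meander n M\<close> M L by (simp add: meander_def composition_def sum_list_const_mult)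
    have "meander (sum_list L1') (L1', L2')"
      using \<open>meander n M\<close> unfolding M L n by (simp add: meander_def comp)
    with \<open>meander_index M = k\<close> have "k = c * meander_index (L1', L2')"
      unfolding M L by (simp add: meander_index_map_times)
    with n M L show ?thesis by (intro exI[of _ "(L1', L2')"]) auto
  qed
  show ?thesis
  proof (cases "c dvd n \<and> c dvd k")
    case True
    then obtain n' k' where nk: "n = c * n'" "k = c * k'" by blast
    have "admissible ((*) c ` J) n k = ?h ` admissible J n' k'"
    proof (intro equalityI subsetI)
      fix M assume M: "M \<in> admissible ((*) c ` J) n k"
      then obtain M' where "M = ?h M'" using ex by blast
      with M h[of M' n' k'] show "M \<in> ?h ` admissible J n' k'" unfolding nk by blast
    next
      fix M assume "M \<in> ?h ` admissible J n' k'"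
      then obtain M' where "M = ?h M'" "M' \<in> admissible J n' k'" by (rule imageE)
      with h[of M' n' k'] show "M \<in> admissible ((*) c ` J) n k" unfolding nk by simp
    qed
    moreover have "inj ?h"
      using c by (intro prod.inj_map list.inj_map) (auto simp: inj_on_def)
    ultimately show ?thesis
      using True c nk unfolding meander_count_def admissible_def[symmetric]
      by (simp add: card_image inj_on_subset)
  next
    case False
    then have "admissible ((*) c ` J) n k = {}" using ex by fastforce
    with False show ?thesis unfolding meander_count_def admissible_def[symmetric] by auto
  qed
qed

lemma fps_compose_X_power_nth:
  fixes F :: "'a :: comm_semiring_1 fps"
  assumes "c \<ge> 1"
  shows "fps_nth (fps_compose F (fps_X ^ c)) n = (if c dvd n then fps_nth F (n div c) else 0)"
proof -
  have "fps_nth (fps_compose F (fps_X ^ c)) n = (\<Sum>i = 0..n. if n = c * i then fps_nth F i else 0)"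
    unfolding fps_compose_nth power_mult[symmetric] by (intro sum.cong) auto
  also have "\<dots> = (if c dvd n then fps_nth F (n div c) else 0)"
  proof (cases "c dvd n")
    case True
    then obtain m where m: "n = c * m" by (elim dvdE)
    have "m \<le> n" using assms m by simp
    have "(\<Sum>i = 0..n. if n = c * i then fps_nth F i else 0) =
        (\<Sum>i = 0..n. if m = i then fps_nth F i else 0)"
      using assms m by (intro sum.cong) auto
    with \<open>m \<le> n\<close> m assms show ?thesis by simp
  next
    case False
    then have "n \<noteq> c * i" for i by auto
    with False show ?thesis by simp
  qed
  finally show ?thesis .
qed

lemma meander_gf_times:
  assumes "c \<ge> 1"
  shows "meander_gf ((*) c ` J) = subst_powers c (meander_gf J)"
proof (intro fps_ext)
  fix n k
  show "fps_nth (fps_nth (meander_gf ((*) c ` J)) n) k =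
      fps_nth (fps_nth (subst_powers c (meander_gf J)) n) k"
    unfolding subst_powers_def fps_compose_X_power_nth[OF assms]
    by (simp add: meander_gf_def meander_count_times[OF assms] fps_compose_X_power_nth[OF assms])
qed

section \<open>Series of meanders with prescribed first parts\<close>

text \<open>The first parts of the two compositions are prescribed to be \<open>p\<close> and \<open>q\<close>, the remaining
  parts are 1, 2 or 3.\<close>

definition tails :: "nat list \<Rightarrow> nat list \<Rightarrow> nat \<Rightarrow> (nat list \<times> nat list) set" where
  "tails p q n = {(L, M). set L \<subseteq> {1, 2, 3} \<and> set M \<subseteq> {1, 2, 3} \<and>
     sum_list p + sum_list L = n \<and> sum_list q + sum_list M = n}"

text \<open>This is the coefficient of \<open>x^n\<close>, a series in the second variable alone, so
  \<open>fps_X\<close> stands for \<open>y\<close> here.\<close>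

definition tails_sum :: "nat list \<Rightarrow> nat list \<Rightarrow> nat \<Rightarrow> rat fps" where
  "tails_sum p q n = (\<Sum>(L, M)\<in>tails p q n. fps_X ^ flip_index (p @ L) (q @ M))"

definition tails_gf :: "nat list \<Rightarrow> nat list \<Rightarrow> rat fps fps" where
  "tails_gf p q = Abs_fps (tails_sum p q)"

lemma length_le_sum_list: "\<forall>a\<in>set L. a > 0 \<Longrightarrow> length L \<le> sum_list (L :: nat list)"
  by (induction L) (auto simp: Suc_le_eq)

lemma finite_tails: "finite (tails p q n)"
proof (rule finite_subset)
  let ?X = "{L. set L \<subseteq> {1, 2, 3 :: nat} \<and> length L \<le> n}"
  show "finite (?X \<times> ?X)" by (intro finite_cartesian_product finite_lists_length_le) auto
  have len: "length L \<le> n" if "set L \<subseteq> {1, 2, 3}" "sum_list p + sum_list L = n" for p L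
    using length_le_sum_list[of L] that by fastforce
  show "tails p q n \<subseteq> ?X \<times> ?X"
    unfolding tails_def using len[of _ p] len[of _ q] by blast
qed

lemma meander_gf_eq_tails_gf: "meander_gf {1, 2, 3} = tails_gf [] []"
proof (intro fps_ext)
  fix n k
  have "{M. meander n M \<and> set (fst M) \<subseteq> {1, 2, 3} \<and> set (snd M) \<subseteq> {1, 2, 3} \<and> meander_index M = k} =
      {M \<in> tails [] [] n. flip_index (fst M) (snd M) = k}"
    by (auto simp: tails_def meander_def composition_def meander_index_eq_flip_index)
  moreover have "fps_nth (fps_nth (tails_gf [] []) n) k =
      of_nat (card {M \<in> tails [] [] n. flip_index (fst M) (snd M) = k})"
  proof -
    have "fps_nth (fps_nth (tails_gf [] []) n) k =
        (\<Sum>M\<in>tails [] [] n. if flip_index (fst M) (snd M) = k then 1 else 0)"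
      by (simp add: tails_gf_def tails_sum_def fps_sum_nth split_beta) (auto intro: sum.cong)
    also have "\<dots> = (\<Sum>M | M \<in> tails [] [] n \<and> flip_index (fst M) (snd M) = k. 1)"
      by (rule sum.inter_filter[OF finite_tails, symmetric])
    finally show ?thesis by simp
  qed
  ultimately show "fps_nth (fps_nth (meander_gf {1, 2, 3}) n) k = fps_nth (fps_nth (tails_gf [] []) n) k"
    by (simp only: meander_gf_def meander_count_def fps_nth_Abs_fps)
qed

text \<open>Common form of the reductions: the tails stay the same and the index drops by a constant
  \<open>d\<close>, which contributes the factor \<open>y^d\<close>.\<close>

lemma tails_sum_mono_index:
  assumes "tails p q n = tails p' q' n'"
    and "\<And>L M. (L, M) \<in> tails p q n \<Longrightarrow> flip_index (p @ L) (q @ M) = d + flip_index (p' @ L) (q' @ M)"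
  shows "tails_sum p q n = fps_X ^ d * tails_sum p' q' n'"
  unfolding tails_sum_def assms(1)[symmetric] sum_distrib_left
  by (rule sum.cong) (auto simp: assms(2) power_add)

lemma tails_sum_eq_0: "n < sum_list p \<Longrightarrow> tails_sum p q n = 0"
  by (auto simp: tails_sum_def tails_def intro!: sum.neutral)

lemma tails_gf_sym: "tails_gf p q = tails_gf q p"
proof (rule fps_ext)
  fix n
  have "tails_sum p q n = tails_sum q p n"
    unfolding tails_sum_def
    by (rule sum.reindex_bij_witness[of _ prod.swap prod.swap])
      (auto simp: tails_def intro!: arg_cong[where f = "(^) fps_X"] flip_index_sym)
  then show "fps_nth (tails_gf p q) n = fps_nth (tails_gf q p) n" by (simp add: tails_gf_def)
qed

text \<open>For positive \<open>n\<close> the upper composition is nonempty and can be sorted by its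
  first part.\<close>

lemma tails_sum_split:
  assumes "n > 0"
  shows "tails_sum [] q n = (\<Sum>a\<in>{1, 2, 3}. tails_sum [a] q n)"
proof -
  have "(\<Sum>a\<in>{1, 2, 3}. tails_sum [a] q n) =
      (\<Sum>(a, M)\<in>Sigma {1, 2, 3} (\<lambda>a. tails [a] q n).
        fps_X ^ flip_index (a # fst M) (q @ snd M))"
    unfolding tails_sum_def by (subst sum.Sigma) (auto simp: finite_tails split_beta)
  also have "\<dots> = tails_sum [] q n"
    unfolding tails_sum_def
  proof (rule sum.reindex_bij_witness[of _ "\<lambda>(L, M). (hd L, tl L, M)" "\<lambda>(a, L, M). (a # L, M)"])
    fix X assume "X \<in> tails [] q n"
    then obtain L M where X: "X = (L, M)" "(L, M) \<in> tails [] q n" by (cases X) auto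
    then obtain a L' where "L = a # L'" using assms by (cases L) (auto simp: tails_def)
    with X show "(case X of (L, M) \<Rightarrow> (hd L, tl L, M)) \<in> Sigma {1, 2, 3} (\<lambda>a. tails [a] q n)"
      "(case (case X of (L, M) \<Rightarrow> (hd L, tl L, M)) of (a, L, M) \<Rightarrow> (a # L, M)) = X"
      by (auto simp: tails_def)
  qed (auto simp: tails_def)
  finally show ?thesis ..
qed

lemma tails_sum_0: "tails_sum [] q 0 = (if q = [] then 1 else 0)" if "\<forall>a\<in>set q. a > 0"
proof (cases "q = []")
  case True
  have "L = []" if "set L \<subseteq> {1, 2, 3}" "sum_list L = (0::nat)" for L
    using that by (cases L) auto
  then have "tails [] [] 0 = {([], [])}" by (auto simp: tails_def)
  with True show ?thesis by (simp add: tails_sum_def flip_index_def num_orbits_def)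
next
  case False
  then obtain a q' where "q = a # q'" by (cases q) auto
  with that have "sum_list q > 0" by simp
  then have "(L, M) \<notin> tails [] q 0" for L M by (auto simp: tails_def simp del: sum_list_eq_0_iff)
  then have "tails [] q 0 = {}" by auto
  with False show ?thesis by (simp add: tails_sum_def)
qed

text \<open>The summand 1 is the empty meander, which has no first part and occurs only for empty
  \<open>q\<close>.\<close>

lemma tails_gf_split:
  assumes "\<forall>a\<in>set q. a > 0"
  shows "tails_gf [] q = (if q = [] then 1 else 0) + (tails_gf [1] q + tails_gf [2] q + tails_gf [3] q)"
proof (rule fps_ext)
  fix n
  show "fps_nth (tails_gf [] q) n =
      fps_nth ((if q = [] then 1 else 0) + (tails_gf [1] q + tails_gf [2] q + tails_gf [3] q)) n"
  proof (cases "n = 0")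
    case True
    then show ?thesis using tails_sum_0[OF assms] tails_sum_eq_0[of 0 "[_]" q]
      by (simp add: tails_gf_def)
  next
    case False
    then show ?thesis using tails_sum_split[of n q] by (simp add: tails_gf_def add_ac)
  qed
qed

lemma tails_gf_same:
  "tails_gf (a # p) (a # q) = fps_X ^ a * fps_const (fps_X ^ a) * tails_gf p q"
proof (rule fps_ext)
  fix n
  have "tails_sum (a # p) (a # q) n = fps_X ^ a * tails_sum p q (n - a)" if "a \<le> n"
    by (rule tails_sum_mono_index)
      (use that in \<open>auto simp: tails_def intro!: flip_index_Cons_same\<close>)
  then show "fps_nth (tails_gf (a # p) (a # q)) n =
      fps_nth (fps_X ^ a * fps_const (fps_X ^ a) * tails_gf p q) n"
    by (simp add: tails_gf_def mult.assoc fps_X_power_mult_nth tails_sum_eq_0)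
qed

text \<open>Deleting a vertex lowers the size by one and keeps tails and index, hence the factor
  \<open>x\<close>.\<close>

lemma tails_gf_reduce:
  assumes "sum_list p = Suc (sum_list p')" "sum_list q = Suc (sum_list q')"
    and "\<And>L M. sum_list (p @ L) = sum_list (q @ M) \<Longrightarrow>
      flip_index (p @ L) (q @ M) = flip_index (p' @ L) (q' @ M)"
  shows "tails_gf p q = fps_X * tails_gf p' q'"
proof (rule fps_ext)
  fix n
  show "fps_nth (tails_gf p q) n = fps_nth (fps_X * tails_gf p' q') n"
  proof (cases n)
    case 0
    then show ?thesis using assms(1) by (simp add: tails_gf_def tails_sum_eq_0)
  next
    case (Suc m)
    have "tails_sum p q n = fps_X ^ 0 * tails_sum p' q' m"
      by (rule tails_sum_mono_index) (use assms Suc in \<open>auto simp: tails_def\<close>)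
    with Suc show ?thesis by (simp add: tails_gf_def)
  qed
qed

lemma tails_gf_1_2: "tails_gf (1 # p) (2 # q) = fps_X * tails_gf p (1 # q)"
  by (rule tails_gf_reduce) (auto simp: flip_index_1_2[simplified])

lemma tails_gf_1_3: "tails_gf (1 # p) (3 # q) = fps_X * tails_gf p (1 # 1 # q)"
  by (rule tails_gf_reduce) (auto simp: flip_index_1_3[simplified])

lemma tails_gf_2_3: "tails_gf (2 # p) (3 # q) = fps_X * tails_gf (1 # p) (2 # q)"
  by (rule tails_gf_reduce) (auto simp: flip_index_2_3[simplified])

section \<open>The linear system and its solution\<close>

lemma fps_divide_eqI:
  fixes A D N :: "'a :: field fps fps"
  assumes "A * D = N" "fps_nth D 0 = 1"
  shows "A = N / D"
proof -
  have "D * inverse D = 1"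
  proof -
    have "fps_nth D 0 * inverse (fps_nth D 0) = 1" by (simp add: assms(2) fps_inverse_one')
    then show ?thesis unfolding fps_inverse_def by (rule fps_right_inverse)
  qed
  then have "N * inverse D = A" by (simp add: assms(1)[symmetric] mult.assoc)
  moreover have "N / D = N * inverse D" by (rule fps_divide_unit) (simp add: assms(2))
  ultimately show ?thesis by simp
qed

lemma solve_system:
  fixes A T U x y :: "'a :: idom"
  assumes U: "U = x * y * T + x * (x * y * A) + x * (x * y * T)"
    and T: "T = x * y * A + x * T + x * U"
    and A: "A = 1 + (x * y + x^2 * y^2 + x^3 * y^3) * A + 2 * (x * T + x * U + x^2 * T)"
  defines "Q \<equiv> 1 - x - x^2 * y - x^3 * y"
  shows "A * (Q * (1 - x * y - x^2 * y^2 - x^3 * y^3) -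
    (2 * x^2 * y + 4 * x^3 * y + 2 * x^3 * y^2 + 2 * x^4 * y^2 + 2 * x^5 * y)) = Q"
    (is "A * (Q * ?P - ?R) = Q")
proof -
  \<comment> \<open>The coefficient of \<open>T\<close> in \<open>x * T + x * U + x^2 * T\<close>
    once \<open>U\<close> is eliminated.\<close>
  define g where "g = x + x^2 + x^2 * y + x^3 * y"
  have "T * Q - (x * y + x^3 * y) * A =
      T - (x * y * A + x * T + x * (x * y * T + x * (x * y * A) + x * (x * y * T)))"
    unfolding Q_def by algebra
  also have "\<dots> = 0" by (rule iffD2[OF right_minus_eq T[unfolded U]])
  finally have TQ: "T * Q = (x * y + x^3 * y) * A" by (simp only: right_minus_eq)
  have "A * ?P - (1 + 2 * T * g + 2 * x^3 * y * A) =
      A - (1 + (x * y + x^2 * y^2 + x^3 * y^3) * A +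
        2 * (x * T + x * (x * y * T + x * (x * y * A) + x * (x * y * T)) + x^2 * T))"
    unfolding g_def by algebra
  also have "\<dots> = 0" by (rule iffD2[OF right_minus_eq A[unfolded U]])
  finally have AP: "A * ?P = 1 + 2 * T * g + 2 * x^3 * y * A" by (simp only: right_minus_eq)
  have "A * (Q * ?P - ?R) = Q * (A * ?P) - A * ?R"
    by algebra
  also have "\<dots> = Q + 2 * g * (T * Q) + 2 * x^3 * y * A * Q - A * ?R"
    unfolding AP by algebra
  also have "\<dots> = Q"
    unfolding TQ unfolding g_def Q_def by algebra
  finally show ?thesis .
qed

theorem theorem4p3:
  shows "(let x = var_x; y = var_y in
            meander_gf {1, 2, 3} =
              (1 - x - x^2 * y - x^3 * y) /
              ((1 - x - x^2 * y - x^3 * y) * (1 - x * y - x^2 * y^2 - x^3 * y^3)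
               - (2 * x^2 * y + 4 * x^3 * y + 2 * x^3 * y^2 + 2 * x^4 * y^2 + 2 * x^5 * y)))
         \<and> (\<forall>c::nat. c \<ge> 1 \<longrightarrow>
              meander_gf {c, 2 * c, 3 * c} = subst_powers c (meander_gf {1, 2, 3}))"
proof (intro conjI allI impI)
  fix c :: nat assume "c \<ge> 1"
  moreover have "{c, 2 * c, 3 * c} = (*) c ` {1, 2, 3}" by auto
  ultimately show "meander_gf {c, 2 * c, 3 * c} = subst_powers c (meander_gf {1, 2, 3})"
    by (simp only: meander_gf_times)
next
  define x y where "x = var_x" and "y = var_y"
  define A T U where "A = tails_gf [] []" and "T = tails_gf [] [1]" and "U = tails_gf [] [1, 1]"
  have same: "tails_gf (a # p) (a # q) = x ^ a * y ^ a * tails_gf p q" for a p q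
    by (simp add: tails_gf_same x_def y_def)
  \<comment> \<open>Sorting by the first part of the other composition: \<open>1/1,1\<close> loses
    its equal parts, \<open>2/1,1\<close> reduces to \<open>1/1\<close>, and \<open>3/1,1\<close>
    reduces to \<open>1/1,1\<close>.\<close>
  have U: "U = x * y * T + x * (x * y * A) + x * (x * y * T)"
  proof -
    have "U = tails_gf [1] [1, 1] + tails_gf [2] [1, 1] + tails_gf [3] [1, 1]"
      unfolding U_def by (subst tails_gf_split) auto
    also have "tails_gf [1] [1, 1] = x * y * T" by (simp del: One_nat_def add: same T_def)
    also have "tails_gf [2] [1, 1] = x * tails_gf [1] [1]"
      by (simp del: One_nat_def add: tails_gf_sym[of "[2]" "[1, 1]"] tails_gf_1_2 x_def)
    also have "tails_gf [1] [1] = x * y * A" by (simp del: One_nat_def add: same A_def)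
    also have "tails_gf [3] [1, 1] = x * tails_gf [1] [1, 1]"
      by (simp del: One_nat_def add: tails_gf_sym[of "[3]"] tails_gf_1_3 x_def)
    also have "tails_gf [1] [1, 1] = x * y * T" by (simp del: One_nat_def add: same T_def)
    finally show ?thesis by simp
  qed
  \<comment> \<open>Here \<open>1/1\<close> loses its equal parts, while \<open>2/1\<close> and
    \<open>3/1\<close> reduce to \<open>T\<close> and \<open>U\<close>.\<close>
  have T: "T = x * y * A + x * T + x * U"
  proof -
    have "T = tails_gf [1] [1] + tails_gf [2] [1] + tails_gf [3] [1]"
      unfolding T_def by (subst tails_gf_split) auto
    also have "tails_gf [1] [1] = x * y * A" by (simp del: One_nat_def add: same A_def)
    also have "tails_gf [2] [1] = x * T"
      by (simp del: One_nat_def add: tails_gf_sym[of "[2]"] tails_gf_1_2 x_def T_def)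
    also have "tails_gf [3] [1] = x * U"
      by (simp del: One_nat_def add: tails_gf_sym[of "[3]"] tails_gf_1_3 x_def U_def)
    finally show ?thesis by simp
  qed
  \<comment> \<open>Both first parts are split off. The three pairs of equal parts give the powers
    of \<open>x * y\<close>; the six others agree in pairs by symmetry, whence the factor 2. The
    pair \<open>2/3\<close> passes through \<open>1/2\<close> to \<open>T\<close>, giving
    \<open>x^2 * T\<close>.\<close>
  have A: "A = 1 + (x * y + x^2 * y^2 + x^3 * y^3) * A + 2 * (x * T + x * U + x^2 * T)"
  proof -
    have first: "tails_gf [a] [] = tails_gf [1] [a] + tails_gf [2] [a] + tails_gf [3] [a]"
      if "a > 0" for a
      using tails_gf_split[of "[a]"] that unfolding tails_gf_sym[of "[a]" "[]"] by simp
    have "tails_gf [1] [1] = x * y * A" "tails_gf [2] [2] = x^2 * y^2 * A"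
      "tails_gf [3] [3] = x^3 * y^3 * A" by (simp_all del: One_nat_def add: same A_def)
    moreover have "tails_gf [1] [2] = x * T" "tails_gf [1] [3] = x * U"
      by (simp_all del: One_nat_def add: tails_gf_1_2 tails_gf_1_3 x_def T_def U_def)
    moreover have "tails_gf [2] [3] = x * (x * T)"
      by (simp del: One_nat_def add: tails_gf_1_2 tails_gf_2_3 x_def T_def)
    moreover have "tails_gf [2] [1] = tails_gf [1] [2]" "tails_gf [3] [1] = tails_gf [1] [3]"
      "tails_gf [3] [2] = tails_gf [2] [3]" by (rule tails_gf_sym)+
    ultimately have "1 + (tails_gf [1] [] + tails_gf [2] [] + tails_gf [3] []) =
        1 + (x * y + x^2 * y^2 + x^3 * y^3) * A + 2 * (x * T + x * U + x^2 * T)"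
      by (simp del: One_nat_def add: first algebra_simps power2_eq_square)
    moreover have "A = 1 + (tails_gf [1] [] + tails_gf [2] [] + tails_gf [3] [])"
      unfolding A_def by (subst tails_gf_split) auto
    ultimately show ?thesis by (rule trans[rotated])
  qed
  let ?Q = "1 - x - x^2 * y - x^3 * y"
  let ?P = "1 - x * y - x^2 * y^2 - x^3 * y^3"
  let ?R = "2 * x^2 * y + 4 * x^3 * y + 2 * x^3 * y^2 + 2 * x^4 * y^2 + 2 * x^5 * y"
  have "A * (?Q * ?P - ?R) = ?Q"
    by (rule solve_system[OF U T A])
  moreover have "fps_nth (?Q * ?P - ?R) 0 = 1"
    by (simp add: x_def)
  ultimately have "A = ?Q / (?Q * ?P - ?R)" by (rule fps_divide_eqI)
  then show "let x = var_x; y = var_y in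
            meander_gf {1, 2, 3} =
              (1 - x - x^2 * y - x^3 * y) /
              ((1 - x - x^2 * y - x^3 * y) * (1 - x * y - x^2 * y^2 - x^3 * y^3)
               - (2 * x^2 * y + 4 * x^3 * y + 2 * x^3 * y^2 + 2 * x^4 * y^2 + 2 * x^5 * y))"
    unfolding Let_def meander_gf_eq_tails_gf A_def x_def y_def .
qed

end
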